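(* Let $M(n)$ be the maximum number of pairwise distinct, non-overlapping Ferrers shapes of size $n$ that can be packed in (i.e. placed inside) an $n\times p(n)$ rectangle. Then $M(n)=\Theta\!\left(\frac{p(n)}{\log n}\right)$; that is, there exist absolute constants $a,b>0$ and an integer $n_0$ such that $a\,\frac{p(n)}{\log n}\le M(n)\le b\,\frac{p(n)}{\log n}$ for all $n\ge n_0$.
   Context: A partition of a positive integer $n$ is an array $(x_1,\dots,x_k)$ of positive integers with $x_1\ge x_2\ge\cdots\ge x_k$ and $\sum_i x_i=n$; $p(n)$ denotes the number of distinct partitions of $n$. The Ferrers shape of the partition $(x_1,\dots,x_k)$ is the planar region formed by $n$ unit square boxes with sides parallel to the coordinate axes, with $x_i$ boxes in the $i$th row (consecutive rows being adjacent), all rows starting at the same vertical line. Its size is $n$. Ferrers shapes of size $n$ correspond bijectively to partitions of $n$, and "distinct" shapes means shapes of distinct partitions. The rectangle has sides parallel to the coordinate axes and side lengths $n$ and $p(n)$. Shapes are placed in the plane with box sides parallel to the axes; a placed shape may have its apex (the corner of its first row and first column) at any of the four corner positions (i.e. a shape may be rotated by multiples of $90^\circ$ or reflected) and may be translated arbitrarily. Each partition is used at most once. Placed shapes are non-overlapping if their interiors are pairwise disjoint. *)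

theory Defs
  imports "HOL-Analysis.Analysis"
begin

definition partitions :: "nat \<Rightarrow> nat list set" where
  "partitions n = {xs. sorted_wrt (\<ge>) xs \<and> (\<forall>x\<in>set xs. 0 < x) \<and> sum_list xs = n}"

definition num_partitions :: "nat \<Rightarrow> nat" where
  "num_partitions n = card (partitions n)"

definition unit_box :: "nat \<Rightarrow> nat \<Rightarrow> (real \<times> real) set" where
  "unit_box i j = {real j..real j + 1} \<times> {real i..real i + 1}"

text \<open>The apex is at the origin; the row with index i (counted from 0) is the strip
  between the heights i and i + 1.\<close>

definition ferrers_shape :: "nat list \<Rightarrow> (real \<times> real) set" where
  "ferrers_shape xs = (\<Union>i<length xs. \<Union>j<xs ! i. unit_box i j)"

text \<open>The eight linear isometries of the plane that preserve the pair of coordinate axes: the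
  rotations by multiples of a right angle and the reflections. Together they move the apex to
  each of the four corner positions, with the rows either horizontal or vertical.\<close>

definition axis_isometries :: "(real \<times> real \<Rightarrow> real \<times> real) set" where
  "axis_isometries =
     {(\<lambda>(x, y). (s * x, t * y)) | s t. s \<in> {1, -1} \<and> t \<in> {1, -1}} \<union>
     {(\<lambda>(x, y). (s * y, t * x)) | s t. s \<in> {1, -1} \<and> t \<in> {1, -1}}"

definition is_placement :: "nat list \<Rightarrow> (real \<times> real) set \<Rightarrow> bool" where
  "is_placement xs R \<longleftrightarrow> (\<exists>f\<in>axis_isometries. \<exists>v. R = (\<lambda>z. v + f z) ` ferrers_shape xs)"

text \<open>S is a set of partitions, so each partition is used at most once; P assigns to every
  member of S the region that its shape occupies.\<close>

definition packable :: "(real \<times> real) set \<Rightarrow> nat list set \<Rightarrow> bool" where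
  "packable A S \<longleftrightarrow>
     (\<exists>P. (\<forall>xs\<in>S. is_placement xs (P xs) \<and> P xs \<subseteq> A) \<and>
          disjoint_family_on (\<lambda>xs. interior (P xs)) S)"

definition partition_rectangle :: "nat \<Rightarrow> (real \<times> real) set" where
  "partition_rectangle n = {0..real n} \<times> {0..real (num_partitions n)}"

definition packing_sizes :: "nat \<Rightarrow> nat set" where
  "packing_sizes n = {card S | S. S \<subseteq> partitions n \<and> packable (partition_rectangle n) S}"

definition max_packing :: "nat \<Rightarrow> nat" where
  "max_packing n = Max (packing_sizes n)"

lemma length_le_sum_list_pos:
  assumes "\<forall>x\<in>set xs. 0 < (x::nat)"
  shows "length xs \<le> sum_list xs"
  using assms by (induction xs) auto

text \<open>The set of partitions is finite, so that its cardinality is meaningful, and the maximum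
  that defines \<^const>\<open>max_packing\<close> is taken over a finite nonempty set.\<close>

lemma finite_partitions: "finite (partitions n)"
proof (rule finite_subset)
  show "partitions n \<subseteq> {xs. set xs \<subseteq> {..n} \<and> length xs \<le> n}"
    by (auto simp: partitions_def length_le_sum_list_pos intro: member_le_sum_list)
  show "finite {xs. set xs \<subseteq> {..n} \<and> length xs \<le> n}"
    by (rule finite_lists_length_le) simp
qed

lemma finite_packing_sizes: "finite (packing_sizes n)"
proof (rule finite_subset)
  show "packing_sizes n \<subseteq> card ` Pow (partitions n)"
    by (auto simp: packing_sizes_def)
qed (simp add: finite_partitions)

lemma packing_sizes_nonempty: "packing_sizes n \<noteq> {}"
proof -
  have "packable (partition_rectangle n) {}"
    by (simp add: packable_def disjoint_family_on_def)
  then have "card ({} :: nat list set) \<in> packing_sizes n"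
    unfolding packing_sizes_def by blast
  then show ?thesis by blast
qed

end

theory Submission
  imports Defs "HOL-Real_Asymp.Real_Asymp"
begin

text \<open>
  A typical partition of \<open>n\<close> has a Ferrers shape whose first row and first column have length of
  order \<open>\<surd>n * ln n\<close>, while the bulk of the shape is a corner of side of order \<open>\<surd>n\<close>. The long
  thin arms waste space: each shape uses an area of order \<open>n * ln n\<close> instead of \<open>n\<close>, and this is the
  factor \<open>ln n\<close> by which a packing misses \<open>p(n)\<close>.

  For the upper bound, consider shapes with the same orientation whose apexes lie in a box as large as
  the arms. A horizontal arm must not cross a vertical arm, so the apexes form a chain that increases
  in both coordinates, and the corners keep the members of the chain at distance of order \<open>\<surd>n\<close>.
  Hence only \<open>O(ln n)\<close> apexes fit into the box (\<open>fat_overlap_ordered\<close>, \<open>card_fat_packing\<close>).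
  Shapes with a short arm or a small corner are so rare, at most \<open>3 p(n) / ln n\<close>, that all of
  them may be admitted (\<open>small_parts_rare\<close>, \<open>thin_rare\<close>).

  For the lower bound, nested shapes are placed along a diagonal: a shape contains no cell whose distance
  from both axes is at least about \<open>\<surd>n\<close>, so that the next apex can be put there. Parallel diagonals at
  distance \<open>2 W\<close>, where \<open>W\<close> of order \<open>\<surd>n * ln n\<close> bounds the arms of at least half of all shapes, are
  independent of each other (\<open>diagonal_slots_disjoint\<close>, \<open>card_bounded_partitions_ge\<close>).

  The facts about partition numbers are obtained without the Hardy-Ramanujan asymptotics, from two
  elementary statements about their growth at distances of order \<open>\<surd>n\<close>. The count at
  least doubles (\<open>pcount_halving\<close>), as a partition has only \<open>O(\<surd>n)\<close> distinct parts. It grows at most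
  by a constant factor (\<open>pcount_ratio\<close>), which follows from Euler's recursion together with the
  doubling. The second statement also holds for partitions whose parts are bounded by a sufficiently
  large multiple of \<open>\<surd>n\<close>, and this is what makes partitions with short arms rare.
\<close>

section \<open>Partitions as multisets\<close>

text \<open>The sum is prescribed as an integer, so that removing a part never has to be guarded against
  truncated subtraction: for negative sums there is nothing to count.\<close>

definition parts_in :: "nat set \<Rightarrow> int \<Rightarrow> nat multiset set" where
  "parts_in A m = {M. set_mset M \<subseteq> A \<and> int (sum_mset M) = m}"

text \<open>The membership condition of \<^const>\<open>parts_in\<close> should keep the sum outside the embedding into the
  integers.\<close>

declare of_nat_sum_mset [simp del]

definition pcount :: "nat set \<Rightarrow> int \<Rightarrow> nat" where
  "pcount A m = card (parts_in A m)"

lemma mset_partitions: "bij_betw mset (partitions n) (parts_in {1..} (int n))"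
proof (rule bij_betw_byWitness[where f' = "\<lambda>M. rev (sorted_list_of_multiset M)"])
  show "\<forall>xs\<in>partitions n. rev (sorted_list_of_multiset (mset xs)) = xs"
  proof
    fix xs assume "xs \<in> partitions n"
    then have "sorted (rev xs)"
      by (simp add: partitions_def sorted_wrt_rev)
    then have "sorted_list_of_multiset (mset (rev xs)) = rev xs"
      by (simp only: sorted_list_of_multiset_mset sorted_sort_id)
    then show "rev (sorted_list_of_multiset (mset xs)) = xs" by simp
  qed
  show "\<forall>M\<in>parts_in {1..} (int n). mset (rev (sorted_list_of_multiset M)) = M"
    by simp
  show "mset ` partitions n \<subseteq> parts_in {1..} (int n)"
    by (auto simp: partitions_def parts_in_def sum_mset_sum_list Suc_le_eq)
  show "(\<lambda>M. rev (sorted_list_of_multiset M)) ` parts_in {1..} (int n) \<subseteq> partitions n"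
  proof (clarify)
    fix M assume M: "M \<in> parts_in {1..} (int n)"
    have "sum_list (rev (sorted_list_of_multiset M)) = sum_mset M"
      by (simp flip: sum_mset_sum_list)
    then show "rev (sorted_list_of_multiset M) \<in> partitions n"
      using M by (auto simp: partitions_def parts_in_def sorted_wrt_rev Suc_le_eq subset_iff)
  qed
qed

lemma num_partitions_eq: "num_partitions n = pcount {1..} (int n)"
  using bij_betw_same_card[OF mset_partitions] by (simp add: num_partitions_def pcount_def)

lemma finite_parts_in:
  assumes "0 \<notin> A"
  shows "finite (parts_in A m)"
proof (cases "m < 0")
  case True
  then have "parts_in A m = {}" by (auto simp: parts_in_def)
  then show ?thesis by simp
next
  case False
  have "A \<subseteq> {1..}" using assms by (auto simp: Suc_le_eq intro!: Nat.gr0I)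
  then have "parts_in A m \<subseteq> parts_in {1..} (int (nat m))"
    using False by (auto simp: parts_in_def)
  moreover have "finite (parts_in {1..} (int (nat m)))"
    using bij_betw_finite[OF mset_partitions] finite_partitions by blast
  ultimately show ?thesis by (rule finite_subset)
qed

lemma pcount_neg: "m < 0 \<Longrightarrow> pcount A m = 0"
  by (auto simp: pcount_def parts_in_def)

lemma pcount_zero_pos: "0 \<notin> A \<Longrightarrow> pcount A 0 \<ge> 1"
proof -
  assume "0 \<notin> A"
  then have "finite (parts_in A 0)" by (rule finite_parts_in)
  moreover have "{#} \<in> parts_in A 0" by (simp add: parts_in_def)
  ultimately show ?thesis unfolding pcount_def
    by (auto simp: Suc_le_eq card_gt_0_iff)
qed

text \<open>Removing \<open>j\<close> copies of \<open>d\<close> is a bijection. This is the source of all recursions below: every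
  statistic of the parts becomes a sum of values of \<^const>\<open>pcount\<close> at smaller arguments.\<close>

lemma card_count_ge:
  assumes "d \<in> A"
  shows "card {M \<in> parts_in A m. j \<le> count M d} = pcount A (m - int j * int d)"
proof -
  have "bij_betw (\<lambda>M. M + replicate_mset j d) (parts_in A (m - int j * int d))
          {M \<in> parts_in A m. j \<le> count M d}"
  proof (rule bij_betw_byWitness[where f' = "\<lambda>M. M - replicate_mset j d"])
    show "\<forall>M\<in>{M \<in> parts_in A m. j \<le> count M d}. M - replicate_mset j d + replicate_mset j d = M"
      by (auto simp: count_le_replicate_mset_subset_eq)
    show "(\<lambda>M. M + replicate_mset j d) ` parts_in A (m - int j * int d)
            \<subseteq> {M \<in> parts_in A m. j \<le> count M d}"
      using assms by (auto simp: parts_in_def split: if_splits)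
    show "(\<lambda>M. M - replicate_mset j d) ` {M \<in> parts_in A m. j \<le> count M d}
            \<subseteq> parts_in A (m - int j * int d)"
    proof clarify
      fix M assume M: "M \<in> parts_in A m" "j \<le> count M d"
      then have "M = (M - replicate_mset j d) + replicate_mset j d"
        by (simp add: count_le_replicate_mset_subset_eq)
      then have "sum_mset M = sum_mset ((M - replicate_mset j d) + replicate_mset j d)"
        by (rule arg_cong)
      then have "sum_mset M = sum_mset (M - replicate_mset j d) + j * d"
        by (simp only: sum_mset.union sum_mset_replicate_mset of_nat_id)
      then have "int (sum_mset (M - replicate_mset j d)) = int (sum_mset M) - int j * int d" by simp
      with M show "M - replicate_mset j d \<in> parts_in A (m - int j * int d)"
        by (auto simp: parts_in_def dest: in_diffD)
    qed
  qed simp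
  then show ?thesis unfolding pcount_def by (metis bij_betw_same_card)
qed

text \<open>Adding parts equal to 1 is injective.\<close>

lemma pcount_mono:
  assumes "1 \<in> A" "0 \<notin> A" "m' \<le> m"
  shows "pcount A m' \<le> pcount A m"
proof -
  have "pcount A m' = card {M \<in> parts_in A m. nat (m - m') \<le> count M 1}"
    using card_count_ge[OF assms(1), of m "nat (m - m')"] assms(3) by simp
  also have "\<dots> \<le> pcount A m"
    unfolding pcount_def by (intro card_mono finite_parts_in assms) auto
  finally show ?thesis .
qed

lemma card_set_sum_ge:
  fixes S :: "nat set"
  assumes "finite S" "0 \<notin> S"
  shows "(card S)\<^sup>2 \<le> 2 * \<Sum>S"
  using assms
proof (induction rule: finite_linorder_max_induct)
  case (insert b S)
  have "S \<subseteq> {1..<b}" using insert by (auto simp: Suc_le_eq intro: Nat.gr0I)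
  then have "card S \<le> b - 1" using card_mono[of "{1..<b}" S] by simp
  moreover have "b \<ge> 1" using insert.prems by (auto simp: Suc_le_eq intro: Nat.gr0I)
  moreover have "b \<notin> S" using insert by auto
  ultimately show ?case using insert by (auto simp: power2_eq_square)
qed simp

lemma sum_mset_eq_sum_count:
  assumes "finite S" "set_mset M \<subseteq> S"
  shows "sum_mset (M :: nat multiset) = (\<Sum>d\<in>S. d * count M d)"
  using assms(2)
proof (induction M)
  case (add x M)
  have "(\<Sum>d\<in>S. d * count (add_mset x M) d)
      = (\<Sum>d\<in>S. d * count M d + (if d = x then x else 0))"
    by (rule sum.cong) auto
  also have "\<dots> = (\<Sum>d\<in>S. d * count M d) + x"
    using add.prems assms(1) by (simp add: sum.distrib)
  finally show ?case using add by simp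
qed simp

section \<open>Growth of the partition numbers\<close>

text \<open>Double counting of the pairs of a partition and one of its distinct parts in \<open>D\<close>.\<close>

lemma sum_pcount_diff:
  assumes "0 \<notin> A" "finite D" "D \<subseteq> A"
  shows "(\<Sum>d\<in>D. pcount A (m - int d)) = (\<Sum>M\<in>parts_in A m. card (set_mset M \<inter> D))"
proof -
  have fin: "finite (parts_in A m)" using assms(1) by (rule finite_parts_in)
  have "(\<Sum>d\<in>D. pcount A (m - int d)) = (\<Sum>d\<in>D. \<Sum>M\<in>parts_in A m. if d \<in># M then 1 else 0)"
  proof (rule sum.cong)
    fix d assume "d \<in> D"
    then have "pcount A (m - int d) = card {M \<in> parts_in A m. 1 \<le> count M d}"
      using card_count_ge[of d A m 1] assms(3) by auto
    also have "{M \<in> parts_in A m. 1 \<le> count M d} = {M \<in> parts_in A m. d \<in># M}"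
      by (auto simp: Suc_le_eq)
    finally show "pcount A (m - int d) = (\<Sum>M\<in>parts_in A m. if d \<in># M then 1 else 0)"
      using fin by (simp add: sum.If_cases Int_def)
  qed simp
  also have "\<dots> = (\<Sum>M\<in>parts_in A m. \<Sum>d\<in>D. if d \<in># M then 1 else 0)"
    by (rule sum.swap)
  also have "\<dots> = (\<Sum>M\<in>parts_in A m. card (set_mset M \<inter> D))"
    using assms(2) by (intro sum.cong) (auto simp: sum.If_cases Int_commute Int_def)
  finally show ?thesis .
qed

text \<open>Distinct positive parts are at least 1, 2, 3 and so on, hence their number is of order \<open>\<surd>m\<close>.\<close>

lemma card_distinct_parts:
  assumes "0 \<notin> A" "M \<in> parts_in A m"
  shows "int ((card (set_mset M))\<^sup>2) \<le> 2 * m"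
proof -
  have 0: "0 \<notin># M" using assms by (auto simp: parts_in_def)
  then have "(card (set_mset M))\<^sup>2 \<le> 2 * \<Sum>(set_mset M)"
    by (intro card_set_sum_ge) auto
  also have "\<Sum>(set_mset M) \<le> (\<Sum>d\<in>set_mset M. d * count M d)"
    by (intro sum_mono) auto
  also have "\<dots> = sum_mset M" by (simp add: sum_mset_eq_sum_count[of "set_mset M"])
  finally have "(card (set_mset M))\<^sup>2 \<le> 2 * sum_mset M" by simp
  then have "int ((card (set_mset M))\<^sup>2) \<le> int (2 * sum_mset M)" by (simp only: of_nat_le_iff)
  then show ?thesis using assms(2) by (simp add: parts_in_def)
qed

text \<open>The \<open>2 r\<close> values at \<open>m - 1, \<dots>, m - 2 r\<close> add up to the total number of distinct small parts,
  which is at most \<open>r\<close> for each partition. Since the values are monotone, the last one is at most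
  half of the value at \<open>m\<close>. So partition numbers at least double over a distance of
  order \<open>\<surd>m\<close>.\<close>

lemma pcount_halving:
  assumes A: "0 \<notin> A" "{1..2 * r} \<subseteq> A" and r: "0 < r" "2 * m \<le> int (r\<^sup>2)"
  shows "2 * pcount A (m - 2 * int r) \<le> pcount A m"
proof -
  have 1: "1 \<in> A" using A(2) r(1) by (auto simp: subset_iff)
  have "2 * r * pcount A (m - 2 * int r) = (\<Sum>d\<in>{1..2 * r}. pcount A (m - 2 * int r))" by simp
  also have "\<dots> \<le> (\<Sum>d\<in>{1..2 * r}. pcount A (m - int d))"
    by (intro sum_mono pcount_mono 1 A(1)) auto
  also have "\<dots> = (\<Sum>M\<in>parts_in A m. card (set_mset M \<inter> {1..2 * r}))"
    using A by (intro sum_pcount_diff) auto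
  also have "\<dots> \<le> (\<Sum>M\<in>parts_in A m. r)"
  proof (rule sum_mono)
    fix M assume "M \<in> parts_in A m"
    then have "int ((card (set_mset M))\<^sup>2) \<le> int (r\<^sup>2)"
      using card_distinct_parts[OF A(1)] r(2) by (metis order_trans)
    then have "card (set_mset M) \<le> r" by (simp add: power2_nat_le_eq_le)
    moreover have "card (set_mset M \<inter> {1..2 * r}) \<le> card (set_mset M)"
      by (intro card_mono) auto
    ultimately show "card (set_mset M \<inter> {1..2 * r}) \<le> r" by simp
  qed
  also have "\<dots> = r * pcount A m" by (simp add: pcount_def)
  finally show ?thesis using r(1) by (simp add: mult.assoc mult.left_commute[of 2 r])
qed

lemma pcount_halving_iter:
  assumes A: "0 \<notin> A" "{1..2 * r} \<subseteq> A" and r: "0 < r" "2 * m \<le> int (r\<^sup>2)"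
  shows "2 ^ i * pcount A (m - 2 * int r * int i) \<le> pcount A m"
proof (induction i)
  case (Suc i)
  let ?k = "m - 2 * int r * int i"
  have "2 * ?k \<le> int (r\<^sup>2)" using r(2) by (smt (verit) of_nat_0_le_iff mult_nonneg_nonneg)
  from pcount_halving[OF A r(1) this] have "2 * pcount A (?k - 2 * int r) \<le> pcount A ?k" .
  moreover have "?k - 2 * int r = m - 2 * int r * int (Suc i)" by (simp add: algebra_simps)
  ultimately have "2 ^ i * (2 * pcount A (m - 2 * int r * int (Suc i))) \<le> 2 ^ i * pcount A ?k"
    by simp
  also have "\<dots> \<le> pcount A m" by (rule Suc)
  finally show ?case by (simp add: mult.assoc mult.left_commute)
qed simp

text \<open>Summing the equation ``the sum of the parts is \<open>n\<close>'' over all partitions of \<open>n\<close>, and counting a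
  part \<open>d\<close> of multiplicity \<open>c\<close> once for each \<open>j = 1, \<dots>, c\<close>, gives Euler's recursion for the partition
  numbers with the divisor sums expanded.\<close>

lemma weighted_sum_pcount:
  assumes A: "0 \<notin> A"
  shows "n * pcount A (int n) \<le> (\<Sum>d\<in>{1..n}. \<Sum>j\<in>{1..n}. d * pcount A (int n - int j * int d))"
proof -
  let ?P = "parts_in A (int n)"
  have fin: "finite ?P" using A by (rule finite_parts_in)
  have "n * pcount A (int n) = (\<Sum>M\<in>?P. n)" by (simp add: pcount_def)
  also have "\<dots> = (\<Sum>M\<in>?P. \<Sum>d\<in>{1..n}. \<Sum>j\<in>{1..n}. if j \<le> count M d then d else 0)"
  proof (rule sum.cong)
    fix M assume M: "M \<in> ?P"
    then have S: "sum_mset M = n" by (auto simp: parts_in_def)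
    have "set_mset M \<subseteq> {1..n}"
    proof
      fix d assume d: "d \<in># M"
      then have "d \<le> sum_mset M" using sum_mset.remove[OF d] by linarith
      moreover have "d \<in> A" using d M unfolding parts_in_def by blast
      then have "d \<noteq> 0" using A by metis
      ultimately show "d \<in> {1..n}" using S by simp
    qed
    then have n: "n = (\<Sum>d\<in>{1..n}. d * count M d)"
      using trans[OF S[symmetric] sum_mset_eq_sum_count[of "{1..n}" M]] by blast
    also have "\<dots> = (\<Sum>d\<in>{1..n}. \<Sum>j\<in>{1..n}. if j \<le> count M d then d else 0)"
    proof (rule sum.cong)
      fix d assume d: "d \<in> {1..n}"
      have "d * count M d \<le> (\<Sum>d\<in>{1..n}. d * count M d)" using d by (intro member_le_sum) auto
      moreover have "count M d \<le> d * count M d" using d by simp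
      ultimately have "count M d \<le> (\<Sum>d\<in>{1..n}. d * count M d)" by (rule order_trans[rotated])
      then have "count M d \<le> n" by (subst n)
      then have "{1..n} \<inter> {j. j \<le> count M d} = {1..count M d}" by auto
      then show "d * count M d = (\<Sum>j\<in>{1..n}. if j \<le> count M d then d else 0)"
        by (simp add: sum.If_cases)
    qed simp
    finally show "n = (\<Sum>d\<in>{1..n}. \<Sum>j\<in>{1..n}. if j \<le> count M d then d else 0)" .
  qed simp
  also have "\<dots> = (\<Sum>d\<in>{1..n}. \<Sum>M\<in>?P. \<Sum>j\<in>{1..n}. if j \<le> count M d then d else 0)"
    by (rule sum.swap)
  also have "\<dots> = (\<Sum>d\<in>{1..n}. \<Sum>j\<in>{1..n}. \<Sum>M\<in>?P. if j \<le> count M d then d else 0)"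
    by (rule sum.cong[OF refl], rule sum.swap)
  also have "\<dots> \<le> (\<Sum>d\<in>{1..n}. \<Sum>j\<in>{1..n}. d * pcount A (int n - int j * int d))"
  proof (intro sum_mono)
    fix d j assume d: "d \<in> {1..n}" and j: "j \<in> {1..n}"
    have "(\<Sum>M\<in>?P. if j \<le> count M d then d else 0) = d * card {M \<in> ?P. j \<le> count M d}"
      using fin by (simp add: sum.If_cases Int_def)
    also have "\<dots> \<le> d * pcount A (int n - int j * int d)"
    proof (cases "d \<in> A")
      case True
      then show ?thesis by (simp add: card_count_ge)
    next
      case False
      then have "count M d = 0" if "M \<in> ?P" for M
        using that by (auto simp: parts_in_def count_eq_zero_iff)
      then have "{M \<in> ?P. j \<le> count M d} = {}" using j by force
      then show ?thesis by (simp only: card.empty)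
    qed
    finally show "(\<Sum>M\<in>?P. if j \<le> count M d then d else 0) \<le> d * pcount A (int n - int j * int d)" .
  qed
  finally show ?thesis .
qed

text \<open>The left-hand side is the sum of the divisor sums of the numbers up to \<open>X\<close>.\<close>

lemma sum_divisor_pairs_le:
  fixes n X :: nat
  shows "(\<Sum>d\<in>{1..n}. \<Sum>j\<in>{1..n}. if j * d \<le> X then d else 0) \<le> X\<^sup>2"
proof -
  have "(\<Sum>d\<in>{1..n}. \<Sum>j\<in>{1..n}. if j * d \<le> X then d else 0) \<le> (\<Sum>d\<in>{1..n}. if d \<le> X then X else 0)"
  proof (rule sum_mono)
    fix d assume d: "d \<in> {1..n}"
    have sub: "{1..n} \<inter> {j. j * d \<le> X} \<subseteq> {1..X div d}"
      using d by (auto simp: less_eq_div_iff_mult_less_eq)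
    then have "card ({1..n} \<inter> {j. j * d \<le> X}) \<le> X div d"
      using card_mono[OF _ sub] by simp
    then have "(\<Sum>j\<in>{1..n}. if j * d \<le> X then d else 0) \<le> d * (X div d)"
      by (simp add: sum.If_cases mult.commute)
    also have "\<dots> \<le> (if d \<le> X then X else 0)" by simp
    finally show "(\<Sum>j\<in>{1..n}. if j * d \<le> X then d else 0) \<le> (if d \<le> X then X else 0)" .
  qed
  also have "\<dots> = card ({1..n} \<inter> {d. d \<le> X}) * X" by (simp add: sum.If_cases)
  also have "\<dots> \<le> X * X"
  proof (rule mult_right_mono)
    have "{1..n} \<inter> {d. d \<le> X} \<subseteq> {1..X}" by auto
    from card_mono[OF _ this] show "card ({1..n} \<inter> {d. d \<le> X}) \<le> X" by simp
  qed simp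
  finally show ?thesis by (simp add: power2_eq_square)
qed

lemma sum_squares_over_powers_le:
  "(\<Sum>i\<in>{T..<N}. (real (i + 1))\<^sup>2 / 2 ^ i) \<le> ((real (T + 1))\<^sup>2 + 2 * real (T + 1) + 3) * 2 / 2 ^ T"
proof (cases "T \<le> N")
  case True
  define g where "g x = ((real (x + 1))\<^sup>2 + 2 * real (x + 1) + 3) * 2 / 2 ^ x" for x :: nat
  have "(\<Sum>i\<in>{T..<N}. (real (i + 1))\<^sup>2 / 2 ^ i) = g T - g N"
    using True
  proof (induction N rule: dec_induct)
    case (step k)
    have "(real (k + 1))\<^sup>2 / 2 ^ k = g k - g (Suc k)"
      by (simp add: g_def field_simps power2_eq_square)
    with step show ?case by simp
  qed simp
  moreover have "g N \<ge> 0" unfolding g_def by (intro divide_nonneg_nonneg mult_nonneg_nonneg add_nonneg_nonneg) auto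
  ultimately show ?thesis by (simp add: g_def)
qed simp

text \<open>Rounding up the square root of \<open>2 n\<close> inside the natural numbers.\<close>

lemma square_between:
  assumes "n > 0"
  obtains r :: nat where "0 < r" "2 * n \<le> r\<^sup>2" "r\<^sup>2 \<le> 4 * n"
proof -
  define r where "r = (LEAST r. 2 * n \<le> r\<^sup>2)"
  have "2 * n \<le> (2 * n)\<^sup>2" by (simp add: power2_eq_square)
  then have r: "2 * n \<le> r\<^sup>2" unfolding r_def by (rule LeastI)
  then have pos: "0 < r" using assms by (cases r) auto
  then obtain k where k: "r = Suc k" by (cases r) auto
  have "\<not> 2 * n \<le> k\<^sup>2" using not_less_Least[of k "\<lambda>r. 2 * n \<le> r\<^sup>2"] k by (simp add: r_def)
  then have less: "k\<^sup>2 < 2 * n" by simp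
  have "k \<le> n"
  proof (rule ccontr)
    assume "\<not> k \<le> n"
    then have "(n + 1)\<^sup>2 \<le> k\<^sup>2" by (intro power_mono) auto
    with less show False by (simp add: power2_eq_square)
  qed
  with less k have "r\<^sup>2 \<le> 4 * n" by (simp add: power2_eq_square)
  with r pos show ?thesis using that by blast
qed

text \<open>The pairs \<open>(d, j)\<close> of the recursion are grouped by the size of \<open>j d\<close>: up to \<open>m\<close>, up to \<open>T D\<close>, and
  in blocks of length \<open>D\<close> beyond that. Within a group the partition number is bounded by
  monotonicity, and the weights add up to at most a square.\<close>

lemma weighted_sum_pcount_split:
  assumes A: "0 \<notin> A" "1 \<in> A" and D: "0 < D"
  defines "f \<equiv> pcount A"
  shows "n * f (int n) \<le> m\<^sup>2 * f (int n) + (T * D)\<^sup>2 * f (int n - int m)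
           + (\<Sum>i\<in>{T..<n * n + T + 1}. ((i + 1) * D)\<^sup>2 * f (int n - int i * int D))"
proof -
  let ?N = "n * n + T + 1"
  define w where "w X = (\<Sum>d\<in>{1..n}. \<Sum>j\<in>{1..n}. if j * d \<le> X then d else 0)" for X
  have mono: "f a \<le> f b" if "a \<le> b" for a b
    unfolding f_def using A that by (intro pcount_mono)
  have "n * f (int n) \<le> (\<Sum>d\<in>{1..n}. \<Sum>j\<in>{1..n}. d * f (int n - int j * int d))"
    unfolding f_def by (rule weighted_sum_pcount[OF A(1)])
  also have "\<dots> \<le> (\<Sum>d\<in>{1..n}. \<Sum>j\<in>{1..n}.
       (if j * d \<le> m then d else 0) * f (int n)
     + (if j * d \<le> T * D then d else 0) * f (int n - int m)
     + (\<Sum>i\<in>{T..<?N}. (if j * d \<le> (i + 1) * D then d else 0) * f (int n - int i * int D)))"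
    (is "_ \<le> (\<Sum>d\<in>_. \<Sum>j\<in>_. ?a d j + ?b d j + (\<Sum>i\<in>_. ?c d j i))")
  proof (intro sum_mono)
    fix d j assume d: "d \<in> {1..n}" and j: "j \<in> {1..n}"
    have jd: "int j * int d = int (j * d)" by simp
    consider "j * d \<le> m" | "m < j * d" "j * d \<le> T * D" | "T * D < j * d" by linarith
    then show "d * f (int n - int j * int d) \<le> ?a d j + ?b d j + (\<Sum>i\<in>{T..<?N}. ?c d j i)"
    proof cases
      case 1
      have "f (int n - int j * int d) \<le> f (int n)" by (rule mono) simp
      then have "d * f (int n - int j * int d) \<le> ?a d j" using 1 by simp
      then show ?thesis by linarith
    next
      case 2
      have "f (int n - int j * int d) \<le> f (int n - int m)" using 2(1) unfolding jd by (intro mono) linarith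
      then have "d * f (int n - int j * int d) \<le> ?b d j" using 2 by simp
      then show ?thesis by linarith
    next
      case 3
      define i where "i = j * d div D"
      have i1: "i * D \<le> j * d" unfolding i_def by simp
      have i2: "j * d \<le> (i + 1) * D" unfolding i_def
        using D by (metis add.commute dividend_less_div_times less_imp_le mult.commute Suc_eq_plus1 mult_Suc)
      have "T \<le> i" unfolding i_def using 3 D by (simp add: less_eq_div_iff_mult_less_eq)
      moreover have "i \<le> n * n"
      proof -
        have "i \<le> j * d" unfolding i_def by simp
        also have "\<dots> \<le> n * n" using d j by (intro mult_mono) auto
        finally show ?thesis .
      qed
      ultimately have i: "i \<in> {T..<?N}" by simp
      have "int i * int D \<le> int j * int d" using i1 by (metis of_nat_le_iff of_nat_mult)
      then have "f (int n - int j * int d) \<le> f (int n - int i * int D)" by (intro mono) linarith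
      then have "d * f (int n - int j * int d) \<le> ?c d j i" using i2 by simp
      also have "\<dots> \<le> (\<Sum>i\<in>{T..<?N}. ?c d j i)" using i by (intro member_le_sum) auto
      finally show ?thesis by linarith
    qed
  qed
  also have "\<dots> = w m * f (int n) + w (T * D) * f (int n - int m)
      + (\<Sum>d\<in>{1..n}. \<Sum>j\<in>{1..n}. \<Sum>i\<in>{T..<?N}. ?c d j i)"
    by (simp only: sum.distrib w_def sum_distrib_right)
  also have "(\<Sum>d\<in>{1..n}. \<Sum>j\<in>{1..n}. \<Sum>i\<in>{T..<?N}. ?c d j i)
      = (\<Sum>d\<in>{1..n}. \<Sum>i\<in>{T..<?N}. \<Sum>j\<in>{1..n}. ?c d j i)"
    by (rule sum.cong[OF refl], rule sum.swap)
  also have "\<dots> = (\<Sum>i\<in>{T..<?N}. \<Sum>d\<in>{1..n}. \<Sum>j\<in>{1..n}. ?c d j i)"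
    by (rule sum.swap)
  also have "\<dots> = (\<Sum>i\<in>{T..<?N}. w ((i + 1) * D) * f (int n - int i * int D))"
    by (simp only: w_def sum_distrib_right)
  also have "w m * f (int n) + w (T * D) * f (int n - int m)
      + (\<Sum>i\<in>{T..<?N}. w ((i + 1) * D) * f (int n - int i * int D))
    \<le> m\<^sup>2 * f (int n) + (T * D)\<^sup>2 * f (int n - int m)
      + (\<Sum>i\<in>{T..<?N}. ((i + 1) * D)\<^sup>2 * f (int n - int i * int D))"
    unfolding w_def by (intro add_mono mult_right_mono sum_mono sum_divisor_pairs_le) auto
  finally show ?thesis .
qed

text \<open>The converse of \<open>pcount_halving\<close>: over a distance \<open>m\<close> of order \<open>\<surd>n\<close> the count drops by at most a
  constant factor. In the recursion, the terms with \<open>j d \<le> m\<close> carry at most a quarter of the left-hand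
  side because \<open>m\<^sup>2 \<le> n / 4\<close>. The terms with \<open>j d > 16 D\<close> carry at most another quarter because of
  the exponential decay from \<open>pcount_halving_iter\<close>. The remaining terms, which are bounded by
  a constant multiple of \<open>n\<close> times the count at \<open>n - m\<close>, must therefore carry the other half.
  The argument needs no asymptotic formula and applies to restricted parts just as well.\<close>

lemma pcount_ratio:
  assumes n: "0 < n" and K: "16 * n \<le> K\<^sup>2" and m: "4 * m\<^sup>2 \<le> n"
  shows "pcount {1..K} (int n) \<le> 8192 * pcount {1..K} (int n - int m)"
proof -
  define f where "f = (\<lambda>k. real (pcount {1..K} k))"
  obtain r :: nat where r: "0 < r" "2 * n \<le> r\<^sup>2" "r\<^sup>2 \<le> 4 * n"
    using n by (rule square_between)
  define D where "D = 2 * r"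
  have D2: "D\<^sup>2 \<le> 16 * n" using r(3) by (simp add: D_def power2_eq_square)
  then have "D\<^sup>2 \<le> K\<^sup>2" using K by linarith
  then have DK: "D \<le> K" by (simp add: power2_nat_le_eq_le)
  have K1: "1 \<in> {1..K}" using DK r(1) by (simp add: D_def)
  have D0: "0 < D" using r by (simp add: D_def)
  have dec: "f (int n - int i * int D) \<le> f (int n) / 2 ^ i" for i
  proof -
    have "2 * int n \<le> int (r\<^sup>2)" using r(2) by linarith
    then have "2 ^ i * pcount {1..K} (int n - 2 * int r * int i) \<le> pcount {1..K} (int n)"
      using DK r by (intro pcount_halving_iter) (auto simp: D_def)
    then have "real (2 ^ i * pcount {1..K} (int n - 2 * int r * int i)) \<le> f (int n)"
      unfolding f_def by (simp only: of_nat_le_iff)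
    moreover have "int n - 2 * int r * int i = int n - int i * int D" by (simp add: D_def)
    ultimately have "2 ^ i * f (int n - int i * int D) \<le> f (int n)" by (simp add: f_def)
    then show ?thesis by (simp add: mult.commute pos_le_divide_eq)
  qed
  have f0: "f x \<ge> 0" for x by (simp add: f_def)
  have D2': "real D ^ 2 \<le> 16 * real n" using D2 by (metis of_nat_le_iff of_nat_mult of_nat_numeral of_nat_power)
  \<comment> \<open>The cut-off 16 makes the tail of the sum of (i + 1)^2 / 2^i smaller than 1/64.\<close>
  have "n * pcount {1..K} (int n) \<le> m\<^sup>2 * pcount {1..K} (int n) + (16 * D)\<^sup>2 * pcount {1..K} (int n - int m)
           + (\<Sum>i\<in>{16..<n * n + 16 + 1}. ((i + 1) * D)\<^sup>2 * pcount {1..K} (int n - int i * int D))"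
    (is "?l \<le> ?r") using K1 D0 by (intro weighted_sum_pcount_split) auto
  then have "real ?l \<le> real ?r" by (simp only: of_nat_le_iff)
  then have "real n * f (int n) \<le> real m ^ 2 * f (int n) + (16 * real D)\<^sup>2 * f (int n - int m)
           + (\<Sum>i\<in>{16..<n * n + 17}. (real (i + 1) * real D)\<^sup>2 * f (int n - int i * int D))"
    by (simp add: f_def algebra_simps)
  also have "(\<Sum>i\<in>{16..<n * n + 17}. (real (i + 1) * real D)\<^sup>2 * f (int n - int i * int D))
      \<le> (\<Sum>i\<in>{16..<n * n + 17}. (real (i + 1) * real D)\<^sup>2 * (f (int n) / 2 ^ i))"
    by (intro sum_mono mult_left_mono dec) auto
  also have "\<dots> = real D ^ 2 * f (int n) * (\<Sum>i\<in>{16..<n * n + 17}. (real (i + 1))\<^sup>2 / 2 ^ i)"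
    by (simp only: sum_distrib_left power_mult_distrib times_divide_eq_right mult_ac)
  also have "\<dots> \<le> (16 * real n) * f (int n) * (((real (16 + 1))\<^sup>2 + 2 * real (16 + 1) + 3) * 2 / 2 ^ 16)"
    using f0 D2' by (intro mult_mono sum_squares_over_powers_le sum_nonneg) auto
  also have "\<dots> \<le> (1 / 4) * real n * f (int n)"
    using f0[of "int n"] by (simp add: mult_right_mono mult_left_mono)
  finally have main: "real n * f (int n) \<le> real m ^ 2 * f (int n) + (16 * real D)\<^sup>2 * f (int n - int m)
      + (1 / 4) * real n * f (int n)" by simp
  have "real (4 * m\<^sup>2) \<le> real n" using m by (simp only: of_nat_le_iff)
  then have "real m ^ 2 * f (int n) \<le> (1 / 4) * real n * f (int n)"
    using f0 by (intro mult_right_mono) auto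
  moreover have "(16 * real D)\<^sup>2 * f (int n - int m) \<le> (4096 * real n) * f (int n - int m)"
    using f0 D2' by (intro mult_right_mono) (auto simp: power_mult_distrib)
  ultimately have "(1 / 2) * real n * f (int n) \<le> 4096 * real n * f (int n - int m)"
    using main by linarith
  then have "real n * f (int n) \<le> real n * (8192 * f (int n - int m))" by linarith
  then have "f (int n) \<le> 8192 * f (int n - int m)" using n by (simp add: mult_le_cancel_left_pos)
  then show ?thesis unfolding f_def by linarith
qed

lemma pcount_ratio_iter:
  assumes K: "16 * n \<le> K\<^sup>2" and m: "4 * m\<^sup>2 + i * m \<le> n" and m0: "0 < m"
  shows "pcount {1..K} (int n) \<le> 8192 ^ i * pcount {1..K} (int n - int i * int m)"
  using m
proof (induction i)
  case (Suc i)
  define k where "k = n - i * m"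
  have k: "int k = int n - int i * int m" using Suc.prems by (simp add: k_def of_nat_diff)
  have k2: "4 * m\<^sup>2 \<le> k" using Suc.prems by (simp add: k_def)
  moreover have "0 < m\<^sup>2" using m0 by simp
  ultimately have k0: "0 < k" by linarith
  have "16 * k \<le> K\<^sup>2" using K by (simp add: k_def)
  from pcount_ratio[OF k0 this k2]
  have "pcount {1..K} (int n - int i * int m) \<le> 8192 * pcount {1..K} (int n - int (Suc i) * int m)"
    by (simp add: k algebra_simps)
  then have "8192 ^ i * pcount {1..K} (int n - int i * int m)
      \<le> 8192 ^ i * (8192 * pcount {1..K} (int n - int (Suc i) * int m))"
    by (rule mult_left_mono) simp
  moreover have "pcount {1..K} (int n) \<le> 8192 ^ i * pcount {1..K} (int n - int i * int m)"
    using Suc.prems by (intro Suc.IH) simp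
  ultimately have "pcount {1..K} (int n) \<le> 8192 ^ i * (8192 * pcount {1..K} (int n - int (Suc i) * int m))"
    by linarith
  then show ?case by (simp only: power_Suc2 mult.assoc)
qed simp

section \<open>Conjugation\<close>

text \<open>The number of parts of size at least \<open>j\<close>; for \<open>j \<ge> 1\<close> it is the length of a column of the Ferrers shape.\<close>

definition tail_count :: "nat multiset \<Rightarrow> nat \<Rightarrow> nat" where
  "tail_count M j = size (filter_mset (\<lambda>x. j \<le> x) M)"

text \<open>Columns beyond the largest part have length 0 and are discarded; \<open>n\<close> is any bound for the parts.\<close>

definition conjugate :: "nat \<Rightarrow> nat multiset \<Rightarrow> nat multiset" where
  "conjugate n M = filter_mset (\<lambda>x. 0 < x) (image_mset (tail_count M) (mset_set {1..n}))"

lemma tail_count_antimono: "i \<le> j \<Longrightarrow> tail_count M j \<le> tail_count M i"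
  unfolding tail_count_def by (induction M) auto

lemma tail_count_Suc: "tail_count M x = count M x + tail_count M (Suc x)"
  unfolding tail_count_def by (induction M) auto

lemma tail_count_eq_0: "(\<And>x. x \<in># M \<Longrightarrow> x < j) \<Longrightarrow> tail_count M j = 0"
  unfolding tail_count_def by (induction M) (auto simp: not_le)

lemma parts_in_bounds:
  assumes "M \<in> parts_in {1..} (int n)" "x \<in># M"
  shows "1 \<le> x" "x \<le> n"
proof -
  show "1 \<le> x" using assms by (auto simp: parts_in_def)
  have "x \<le> sum_mset M" using sum_mset.remove[OF assms(2)] by linarith
  then show "x \<le> n" using assms(1) by (simp add: parts_in_def)
qed

lemma sum_tail_count:
  assumes "\<And>x. x \<in># M \<Longrightarrow> x \<le> n"
  shows "(\<Sum>j\<in>{1..n}. tail_count M j) = sum_mset M"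
  using assms
proof (induction M)
  case (add x M)
  have "(\<Sum>j\<in>{1..n}. tail_count (add_mset x M) j)
      = (\<Sum>j\<in>{1..n}. tail_count M j + (if j \<le> x then 1 else 0))"
    by (rule sum.cong) (auto simp: tail_count_def)
  also have "\<dots> = sum_mset M + card ({1..n} \<inter> {j. j \<le> x})"
    using add by (simp add: sum.distrib sum.If_cases)
  also have "{1..n} \<inter> {j. j \<le> x} = {1..x}" using add.prems[of x] by auto
  finally show ?case by simp
qed (simp add: tail_count_def)

lemma sum_mset_filter_pos: "sum_mset (filter_mset (\<lambda>x. 0 < x) M) = sum_mset (M :: nat multiset)"
  by (induction M) auto

lemma conjugate_in_parts:
  assumes "M \<in> parts_in {1..} (int n)"
  shows "conjugate n M \<in> parts_in {1..} (int n)"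
proof -
  have "sum_mset (conjugate n M) = (\<Sum>j\<in>{1..n}. tail_count M j)"
    unfolding conjugate_def sum_mset_filter_pos by (simp add: sum_unfold_sum_mset)
  also have "\<dots> = sum_mset M"
    using parts_in_bounds(2)[OF assms] by (rule sum_tail_count)
  finally show ?thesis using assms by (auto simp: parts_in_def conjugate_def Suc_le_eq)
qed

lemma tail_count_conjugate:
  assumes "0 < i"
  shows "tail_count (conjugate n M) i = card {j \<in> {1..n}. i \<le> tail_count M j}"
proof -
  have "filter_mset (\<lambda>x. i \<le> x) (conjugate n M)
      = image_mset (tail_count M) (filter_mset (\<lambda>j. i \<le> tail_count M j) (mset_set {1..n}))"
    using assms unfolding conjugate_def
    by (auto simp: filter_mset_image_mset comp_def filter_filter_mset intro!: filter_mset_cong arg_cong[where f = "image_mset _"])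
  then show ?thesis unfolding tail_count_def[of "conjugate n M"]
    by (simp add: filter_mset_mset_set)
qed

text \<open>An antitone sequence is recovered from its level counts, which is why conjugation loses nothing.\<close>

lemma antimono_ge_iff_card:
  fixes f :: "nat \<Rightarrow> nat"
  assumes "\<And>i j. i \<le> j \<Longrightarrow> f j \<le> f i" and j: "j \<in> {1..n}"
  shows "k \<le> f j \<longleftrightarrow> j \<le> card {j \<in> {1..n}. k \<le> f j}"
proof
  assume "k \<le> f j"
  then have "{1..j} \<subseteq> {j \<in> {1..n}. k \<le> f j}"
    using assms by (auto intro: order_trans)
  from card_mono[OF _ this] show "j \<le> card {j \<in> {1..n}. k \<le> f j}" by simp
next
  assume *: "j \<le> card {j \<in> {1..n}. k \<le> f j}"
  show "k \<le> f j"
  proof (rule ccontr)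
    assume "\<not> k \<le> f j"
    then have "{j \<in> {1..n}. k \<le> f j} \<subseteq> {1..<j}"
      using assms(1) by (auto simp: not_le) (meson not_le order_trans)
    from card_mono[OF _ this] have "card {j \<in> {1..n}. k \<le> f j} \<le> j - 1" by simp
    moreover have "0 < j" using j by simp
    ultimately show False using * by linarith
  qed
qed

lemma inj_on_conjugate: "inj_on (conjugate n) (parts_in {1..} (int n))"
proof (rule inj_onI)
  fix M N assume M: "M \<in> parts_in {1..} (int n)" and N: "N \<in> parts_in {1..} (int n)"
    and eq: "conjugate n M = conjugate n N"
  have ge: "k \<le> tail_count M j \<longleftrightarrow> k \<le> tail_count N j" if "j \<in> {1..n}" for k j
  proof (cases "k = 0")
    case False
    have "k \<le> tail_count M j \<longleftrightarrow> j \<le> tail_count (conjugate n M) k"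
      using False antimono_ge_iff_card[where f = "tail_count M" and k = k, OF tail_count_antimono that]
      by (simp add: tail_count_conjugate)
    also have "\<dots> \<longleftrightarrow> k \<le> tail_count N j"
      using False antimono_ge_iff_card[where f = "tail_count N" and k = k, OF tail_count_antimono that]
      by (simp add: eq tail_count_conjugate)
    finally show ?thesis .
  qed simp
  have tail: "tail_count M j = tail_count N j" if "1 \<le> j" for j
  proof (cases "j \<le> n")
    case True
    then show ?thesis using ge[of j] that by (metis atLeastAtMost_iff order_antisym order_refl)
  next
    case False
    then have "x < j" if "x \<in># M \<or> x \<in># N" for x
      using that parts_in_bounds(2)[OF M] parts_in_bounds(2)[OF N] by force
    then show ?thesis by (simp add: tail_count_eq_0)
  qed
  show "M = N"
  proof (rule multiset_eqI)
    fix x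
    show "count M x = count N x"
    proof (cases "x = 0")
      case True
      then have "x \<notin># M" "x \<notin># N" using parts_in_bounds(1)[OF M] parts_in_bounds(1)[OF N] by force+
      then show ?thesis by (simp add: not_in_iff)
    next
      case False
      then show ?thesis using tail[of x] tail[of "Suc x"] tail_count_Suc[of M x] tail_count_Suc[of N x]
        by simp
    qed
  qed
qed

lemma conjugate_parts_le_size:
  assumes "x \<in># conjugate n M"
  shows "x \<le> size M"
proof -
  obtain j where "x = tail_count M j" using assms by (auto simp: conjugate_def)
  then show ?thesis by (simp add: tail_count_def size_filter_mset_lesseq)
qed

lemma size_in_conjugate:
  assumes "M \<in> parts_in {1..} (int n)" "0 < size M"
  shows "size M \<in># conjugate n M"
proof -
  have "filter_mset (\<lambda>x. 1 \<le> x) M = filter_mset (\<lambda>x. True) M"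
    using parts_in_bounds(1)[OF assms(1)] by (intro filter_mset_cong) auto
  then have "tail_count M 1 = size M" by (simp add: tail_count_def)
  moreover obtain x where "x \<in># M" using assms(2) by (metis multiset_nonemptyE size_empty less_irrefl)
  then have "1 \<in> {1..n}" using parts_in_bounds[OF assms(1)] by fastforce
  ultimately show ?thesis using assms(2) unfolding conjugate_def
    by (metis (no_types, lifting) count_greater_zero_iff finite_atLeastAtMost finite_set_mset_mset_set
        image_eqI mem_Collect_eq set_image_mset set_mset_filter)
qed

text \<open>Conjugation turns the number of parts into the largest part. Only its injectivity matters, since
  upper bounds suffice.\<close>

lemma card_size_le:
  "card {M \<in> parts_in {1..} (int n). size M \<le> K} \<le> pcount {1..K} (int n)"
proof -
  have "conjugate n ` {M \<in> parts_in {1..} (int n). size M \<le> K} \<subseteq> parts_in {1..K} (int n)"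
  proof clarify
    fix M assume M: "M \<in> parts_in {1..} (int n)" "size M \<le> K"
    have "x \<le> K" if "x \<in># conjugate n M" for x
      using conjugate_parts_le_size[OF that] M(2) by simp
    then show "conjugate n M \<in> parts_in {1..K} (int n)"
      using conjugate_in_parts[OF M(1)] by (auto simp: parts_in_def)
  qed
  moreover have "inj_on (conjugate n) {M \<in> parts_in {1..} (int n). size M \<le> K}"
    by (rule inj_on_subset[OF inj_on_conjugate]) auto
  ultimately show ?thesis unfolding pcount_def
    by (intro card_inj_on_le[of "conjugate n"] finite_parts_in) auto
qed

lemma card_size_gr:
  "card {M \<in> parts_in {1..} (int n). W < size M} \<le> card {M \<in> parts_in {1..} (int n). \<exists>x\<in>#M. W < x}"
proof -
  have "conjugate n ` {M \<in> parts_in {1..} (int n). W < size M} \<subseteq> {M \<in> parts_in {1..} (int n). \<exists>x\<in>#M. W < x}"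
    using conjugate_in_parts size_in_conjugate by fastforce
  moreover have "inj_on (conjugate n) {M \<in> parts_in {1..} (int n). W < size M}"
    by (rule inj_on_subset[OF inj_on_conjugate]) auto
  moreover have "finite {M \<in> parts_in {1..} (int n). \<exists>x\<in>#M. W < x}"
    using finite_parts_in[of "{1..}" "int n"] by simp
  ultimately show ?thesis by (intro card_inj_on_le[of "conjugate n"]) auto
qed

section \<open>Atypical partitions are rare\<close>

lemma pcount_ge_power:
  assumes r: "0 < r" "2 * n \<le> r\<^sup>2" and i: "2 * r * i \<le> n"
  shows "2 ^ i \<le> pcount {1..} (int n)"
proof -
  have "int (2 * r * i) \<le> int n" using i by (simp only: of_nat_le_iff)
  then have "0 \<le> int n - 2 * int r * int i" by simp
  then have "pcount {1..} 0 \<le> pcount {1..} (int n - 2 * int r * int i)"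
    by (intro pcount_mono) auto
  with pcount_zero_pos[of "{1..}"] have "1 \<le> pcount {1..} (int n - 2 * int r * int i)" by simp
  then have "2 ^ i * 1 \<le> 2 ^ i * pcount {1..} (int n - 2 * int r * int i)" by (intro mult_left_mono) auto
  also have "\<dots> \<le> pcount {1..} (int n)"
  proof (rule pcount_halving_iter)
    have "int (2 * n) \<le> int (r\<^sup>2)" using r(2) by (simp only: of_nat_le_iff)
    then show "2 * int n \<le> int (r\<^sup>2)" by simp
  qed (use r in auto)
  finally show ?thesis by simp
qed

text \<open>Adjoining one part \<open>k > K\<close> to a partition with parts at most \<open>K\<close> loses no information, as \<open>k\<close> remains
  recognizable as the only large part.\<close>

lemma sum_pcount_unique_large_part:
  "(\<Sum>k\<in>{K<..J}. pcount {1..K} (m - int k)) \<le> pcount {1..} m"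
proof -
  let ?S = "SIGMA k:{K<..J}. parts_in {1..K} (m - int k)"
  have "(\<Sum>k\<in>{K<..J}. pcount {1..K} (m - int k)) = card ?S"
    unfolding pcount_def by (intro card_SigmaI[symmetric] ballI finite_parts_in) auto
  also have "\<dots> \<le> card (parts_in {1..} m)"
  proof (rule card_inj_on_le[of "\<lambda>(k, M). add_mset k M"])
    show "inj_on (\<lambda>(k, M). add_mset k M) ?S"
    proof (rule inj_onI, clarify)
      fix k M k' M'
      assume k: "k \<in> {K<..J}" "k' \<in> {K<..J}" and M: "M \<in> parts_in {1..K} (m - int k)"
        "M' \<in> parts_in {1..K} (m - int k')" and eq: "add_mset k M = add_mset k' M'"
      have "k \<notin># M'" using M(2) k(1) by (auto simp: parts_in_def)
      then have "k = k'" using eq by (metis insert_noteq_member)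
      with eq show "k = k' \<and> M = M'" by simp
    qed
    show "(\<lambda>(k, M). add_mset k M) ` ?S \<subseteq> parts_in {1..} m"
      by (fastforce simp: parts_in_def)
  qed (simp add: finite_parts_in)
  finally show ?thesis by (simp add: pcount_def)
qed

text \<open>If all parts are at most \<open>K = L m\<close>, then a part between \<open>K\<close> and \<open>2 K\<close> can be adjoined to a partition
  of a correspondingly smaller number. There are \<open>K\<close> choices for this part, and going from \<open>n\<close> down
  to \<open>n - 2 K\<close> costs only \<open>2 L\<close> constant factors. For \<open>L\<close> a small multiple of \<open>ln n\<close> and \<open>m\<close> of
  order \<open>\<surd>n\<close> the gain exceeds the loss.\<close>

lemma few_small_part_partitions:
  assumes "16 * n \<le> (L * m)\<^sup>2" "4 * m\<^sup>2 + 2 * L * m \<le> n" "0 < m"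
  shows "L * m * pcount {1..L * m} (int n) \<le> 8192 ^ (2 * L) * pcount {1..} (int n)"
proof -
  let ?K = "L * m"
  have K: "1 \<in> {1..?K}"
  proof -
    have "0 < n" using assms(2,3) by (cases n) auto
    then have "0 < ?K\<^sup>2" using assms(1) by linarith
    then have "0 < ?K" by simp
    then have "1 \<le> ?K" by linarith
    then show ?thesis by (simp only: atLeastAtMost_iff order_refl simp_thms)
  qed
  have "pcount {1..?K} (int n) \<le> 8192 ^ (2 * L) * pcount {1..?K} (int n - int (2 * L) * int m)"
    using assms by (intro pcount_ratio_iter)
  moreover have "int (2 * L) * int m = int (2 * ?K)" by simp
  ultimately have "?K * pcount {1..?K} (int n)
      \<le> 8192 ^ (2 * L) * (?K * pcount {1..?K} (int n - int (2 * ?K)))"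
    using mult_left_mono[of _ _ ?K] by (simp only: mult.left_commute)
  also have "?K * pcount {1..?K} (int n - int (2 * ?K)) = (\<Sum>k\<in>{?K<..2 * ?K}. pcount {1..?K} (int n - int (2 * ?K)))"
    by simp
  also have "\<dots> \<le> (\<Sum>k\<in>{?K<..2 * ?K}. pcount {1..?K} (int n - int k))"
  proof (intro sum_mono pcount_mono K)
    fix k assume "k \<in> {?K<..2 * ?K}"
    then have "int k \<le> int (2 * ?K)" by (simp only: of_nat_le_iff greaterThanAtMost_iff)
    then show "int n - int (2 * ?K) \<le> int n - int k" by linarith
  qed simp
  also have "\<dots> \<le> pcount {1..} (int n)" by (rule sum_pcount_unique_large_part)
  finally show ?thesis by simp
qed

lemma card_large_part_le:
  "card {M \<in> parts_in {1..} (int n). \<exists>x\<in>#M. W < x} \<le> n * pcount {1..} (int n - int W)"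
proof -
  have "{M \<in> parts_in {1..} (int n). \<exists>x\<in>#M. W < x}
      \<subseteq> (\<Union>x\<in>{W<..n}. {M \<in> parts_in {1..} (int n). 1 \<le> count M x})"
    using parts_in_bounds(2) by (fastforce simp: Suc_le_eq)
  then have "card {M \<in> parts_in {1..} (int n). \<exists>x\<in>#M. W < x}
      \<le> card (\<Union>x\<in>{W<..n}. {M \<in> parts_in {1..} (int n). 1 \<le> count M x})"
    by (intro card_mono) (auto simp: finite_parts_in)
  also have "\<dots> \<le> (\<Sum>x\<in>{W<..n}. card {M \<in> parts_in {1..} (int n). 1 \<le> count M x})"
    by (rule card_UN_le) simp
  also have "\<dots> \<le> (\<Sum>x\<in>{W<..n}. pcount {1..} (int n - int W))"
  proof (rule sum_mono)
    fix x assume x: "x \<in> {W<..n}"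
    then have "card {M \<in> parts_in {1..} (int n). 1 \<le> count M x} = pcount {1..} (int n - int x)"
      using card_count_ge[of x "{1..}" "int n" 1] by auto
    also have "\<dots> \<le> pcount {1..} (int n - int W)" using x by (intro pcount_mono) auto
    finally show "card {M \<in> parts_in {1..} (int n). 1 \<le> count M x} \<le> pcount {1..} (int n - int W)" .
  qed
  also have "\<dots> \<le> n * pcount {1..} (int n - int W)" by simp
  finally show ?thesis .
qed

lemma pcount_add_part:
  "pcount {1..Suc s} m \<le> pcount {1..s} m + pcount {1..Suc s} (m - int (Suc s))"
proof -
  have "parts_in {1..Suc s} m \<subseteq> parts_in {1..s} m \<union> {M \<in> parts_in {1..Suc s} m. 1 \<le> count M (Suc s)}"
  proof
    fix M assume M: "M \<in> parts_in {1..Suc s} m"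
    show "M \<in> parts_in {1..s} m \<union> {M \<in> parts_in {1..Suc s} m. 1 \<le> count M (Suc s)}"
    proof (cases "Suc s \<in># M")
      case True
      then have "1 \<le> count M (Suc s)" by (simp add: Suc_le_eq)
      with M show ?thesis by simp
    next
      case False
      have "set_mset M \<subseteq> {1..s}"
      proof
        fix x assume x: "x \<in># M"
        then have "x \<in> {1..Suc s}" "x \<noteq> Suc s" using M False by (auto simp: parts_in_def)
        then show "x \<in> {1..s}" by simp
      qed
      with M show ?thesis by (simp add: parts_in_def)
    qed
  qed
  then have "card (parts_in {1..Suc s} m)
      \<le> card (parts_in {1..s} m \<union> {M \<in> parts_in {1..Suc s} m. 1 \<le> count M (Suc s)})"
    by (intro card_mono) (auto simp: finite_parts_in)
  also have "\<dots> \<le> card (parts_in {1..s} m) + card {M \<in> parts_in {1..Suc s} m. 1 \<le> count M (Suc s)}"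
    by (rule card_Un_le)
  also have "card {M \<in> parts_in {1..Suc s} m. 1 \<le> count M (Suc s)} = pcount {1..Suc s} (m - int (Suc s))"
    using card_count_ge[of "Suc s" "{1..Suc s}" m 1] by simp
  finally show ?thesis by (simp add: pcount_def)
qed

text \<open>The generating function of the partitions into parts at most \<open>s\<close> at the argument \<open>x = 1 / y\<close> with
  \<open>y = 1 + 1 / N\<close>: Bernoulli's inequality gives \<open>1 - x^d \<ge> d / (N + d)\<close>, and the product of the factors
  \<open>(N + d) / d\<close> is a binomial coefficient. The proof is an induction along \<open>pcount_add_part\<close>.\<close>

lemma pcount_generating_bound:
  assumes N: "0 < N"
  shows "real (pcount {1..s} (int n)) \<le> (1 + 1 / real N) ^ n * real ((N + s) choose s)"
proof (induction s arbitrary: n)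
  case 0
  have "parts_in {1..0} (int n) \<subseteq> {{#}}" by (auto simp: parts_in_def)
  from card_mono[OF _ this] have "pcount {1..0} (int n) \<le> 1" by (simp add: pcount_def)
  then have "real (pcount {1..0} (int n)) \<le> 1" by linarith
  also have "1 \<le> (1 + 1 / real N) ^ n" by (simp add: one_le_power)
  finally show ?case by simp
next
  case (Suc s)
  define y where "y = 1 + 1 / real N"
  define C where "C = real ((N + s) choose s)"
  define C' where "C' = real ((N + Suc s) choose Suc s)"
  have y: "1 \<le> y" by (simp add: y_def)
  have C0: "C \<ge> 0" "C' \<ge> 0" by (simp_all add: C_def C'_def)
  have "Suc s * (Suc (N + s) choose Suc s) = Suc (N + s) * ((N + s) choose s)"
    by (rule Suc_times_binomial)
  then have "real (Suc s * (Suc (N + s) choose Suc s)) = real (Suc (N + s) * ((N + s) choose s))"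
    by (rule arg_cong)
  then have CC: "real (Suc s) * C' = real (N + Suc s) * C"
    unfolding C_def C'_def add_Suc_right of_nat_mult .
  have "1 + real (Suc s) * (1 / real N) \<le> y ^ Suc s"
    unfolding y_def by (rule Bernoulli_inequality) (simp add: order_trans[of _ 0])
  then have "real N * (1 + real (Suc s) * (1 / real N)) \<le> real N * y ^ Suc s"
    by (rule mult_left_mono) simp
  moreover have "real N * (1 + real (Suc s) * (1 / real N)) = real (N + Suc s)"
    using N by (simp add: field_simps)
  ultimately have ys: "real (N + Suc s) \<le> real N * y ^ Suc s" by simp
  have step: "C + C' / y ^ Suc s \<le> C'"
  proof -
    have y0: "0 < y ^ Suc s" using y by (intro zero_less_power) simp
    have "real (N + Suc s) * C' \<le> real N * y ^ Suc s * C'"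
      using ys C0(2) by (rule mult_right_mono)
    then have "real (N + Suc s) * (C' / y ^ Suc s) \<le> real N * C'"
      using y0 by (simp add: field_simps)
    moreover have "real (N + Suc s) * C = real (Suc s) * C'" using CC by simp
    ultimately have "real (N + Suc s) * (C + C' / y ^ Suc s) \<le> real (N + Suc s) * C'"
      by (simp add: algebra_simps)
    then show ?thesis using N by (simp add: mult_le_cancel_left_pos)
  qed
  show ?case unfolding y_def[symmetric] C'_def[symmetric]
  proof (induction n rule: less_induct)
    case (less n)
    have "real (pcount {1..Suc s} (int n)) \<le> real (pcount {1..s} (int n) + pcount {1..Suc s} (int n - int (Suc s)))"
      by (simp only: of_nat_le_iff pcount_add_part)
    also have "\<dots> = real (pcount {1..s} (int n)) + real (pcount {1..Suc s} (int n - int (Suc s)))" by simp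
    also have "real (pcount {1..s} (int n)) \<le> y ^ n * C"
      using Suc.IH[of n] by (simp add: y_def C_def)
    also have "real (pcount {1..Suc s} (int n - int (Suc s))) \<le> y ^ n * (C' / y ^ Suc s)"
    proof (cases "Suc s \<le> n")
      case True
      then have "int n - int (Suc s) = int (n - Suc s)" by simp
      then have "real (pcount {1..Suc s} (int n - int (Suc s))) \<le> y ^ (n - Suc s) * C'"
        using less[of "n - Suc s"] True by simp
      also have "y ^ (n - Suc s) = y ^ n / y ^ Suc s"
        using True y by (intro power_diff) auto
      finally show ?thesis by (simp add: field_simps)
    next
      case False
      then have "pcount {1..Suc s} (int n - int (Suc s)) = 0" by (intro pcount_neg) simp
      then show ?thesis using y C0 by simp
    qed
    finally have "real (pcount {1..Suc s} (int n)) \<le> y ^ n * (C + C' / y ^ Suc s)"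
      by (simp add: algebra_simps)
    also have "\<dots> \<le> y ^ n * C'" using step y by (intro mult_left_mono) auto
    finally show ?case .
  qed
qed

text \<open>A partition with at most \<open>s\<close> parts above \<open>s\<close> splits into those few parts and its parts of size at
  most \<open>s\<close>. By conjugation both pieces are counted by partitions with parts at most \<open>s\<close>.\<close>

lemma card_thin_le:
  assumes N: "0 < N"
  shows "real (card {M \<in> parts_in {1..} (int n). size (filter_mset (\<lambda>x. s < x) M) \<le> s})
    \<le> real (n + 1) * ((1 + 1 / real N) ^ n * real ((N + s) choose s))\<^sup>2"
proof -
  let ?T = "{M \<in> parts_in {1..} (int n). size (filter_mset (\<lambda>x. s < x) M) \<le> s}"
  let ?A = "\<lambda>a. {M \<in> parts_in {1..} (int a). size M \<le> s}"
  let ?B = "\<lambda>a. parts_in {1..s} (int (n - a))"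
  let ?g = "\<lambda>M. (filter_mset (\<lambda>x. s < x) M, filter_mset (\<lambda>x. \<not> s < x) M)"
  let ?b = "(1 + 1 / real N) ^ n * real ((N + s) choose s)"
  have bound: "real (pcount {1..s} (int a)) \<le> ?b" if "a \<le> n" for a
  proof -
    have "real (pcount {1..s} (int a)) \<le> (1 + 1 / real N) ^ a * real ((N + s) choose s)"
      by (rule pcount_generating_bound[OF N])
    also have "\<dots> \<le> ?b" using that by (intro mult_right_mono power_increasing) auto
    finally show ?thesis .
  qed
  have "card ?T \<le> card (\<Union>a\<in>{..n}. ?A a \<times> ?B a)"
  proof (rule card_inj_on_le[of ?g])
    show "inj_on ?g ?T"
      by (rule inj_onI) (metis multiset_partition prod.inject)
    show "?g ` ?T \<subseteq> (\<Union>a\<in>{..n}. ?A a \<times> ?B a)"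
    proof clarify
      fix M assume M: "M \<in> parts_in {1..} (int n)" and size: "size (filter_mset (\<lambda>x. s < x) M) \<le> s"
      define X Y where "X = filter_mset (\<lambda>x. s < x) M" and "Y = filter_mset (\<lambda>x. \<not> s < x) M"
      have "M = X + Y" unfolding X_def Y_def by (rule multiset_partition)
      then have "sum_mset M = sum_mset X + sum_mset Y" by simp
      then have n: "sum_mset X + sum_mset Y = n" using M by (simp add: parts_in_def)
      have "X \<in> ?A (sum_mset X)" using M size unfolding X_def by (auto simp: parts_in_def)
      moreover have "Y \<in> ?B (sum_mset X)" using M n unfolding Y_def by (auto simp: parts_in_def)
      ultimately show "(X, Y) \<in> (\<Union>a\<in>{..n}. ?A a \<times> ?B a)" using n by force
    qed
  qed (auto simp: finite_parts_in)
  also have "\<dots> \<le> (\<Sum>a\<in>{..n}. card (?A a \<times> ?B a))" by (rule card_UN_le) simp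
  finally have "real (card ?T) \<le> (\<Sum>a\<in>{..n}. real (card (?A a)) * real (card (?B a)))"
    by (simp add: card_cartesian_product flip: of_nat_sum of_nat_mult)
  also have "\<dots> \<le> (\<Sum>a\<in>{..n}. ?b * ?b)"
  proof (rule sum_mono, rule mult_mono)
    fix a assume a: "a \<in> {..n}"
    have "real (card (?A a)) \<le> real (pcount {1..s} (int a))" by (simp only: of_nat_le_iff card_size_le)
    also have "\<dots> \<le> ?b" using a by (intro bound) simp
    finally show "real (card (?A a)) \<le> ?b" .
    show "real (card (?B a)) \<le> ?b" using bound[of "n - a"] by (simp add: pcount_def)
  qed auto
  also have "\<dots> = real (n + 1) * ?b\<^sup>2" by (simp add: power2_eq_square)
  finally show ?thesis .
qed

text \<open>One term of the binomial expansion of \<open>(1 / u + 1)^(u s + s)\<close>.\<close>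

lemma binomial_exp_bound:
  assumes "0 < u"
  shows "real ((u * s + s) choose s) \<le> real u ^ s * exp (2 * real s)"
proof -
  have "real ((u * s + s) choose s) * (1 / real u) ^ s * 1 ^ (u * s + s - s) \<le> (1 / real u + 1) ^ (u * s + s)"
    unfolding binomial_ring[of "1 / real u" 1] by (rule member_le_sum[of s]) auto
  also have "\<dots> \<le> exp (1 / real u) ^ (u * s + s)"
    using exp_ge_add_one_self[of "1 / real u"] by (intro power_mono) (auto simp: add.commute)
  also have "\<dots> = exp (real (u * s + s) * (1 / real u))" by (rule exp_of_nat_mult[symmetric])
  also have "\<dots> \<le> exp (2 * real s)"
  proof -
    have "real s * 1 \<le> real s * real u" using assms by (intro mult_left_mono) auto
    then have "real (u * s + s) \<le> 2 * real s * real u" by simp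
    then show ?thesis using assms by (simp add: pos_divide_le_eq)
  qed
  finally have "real ((u * s + s) choose s) * (1 / real u) ^ s \<le> exp (2 * real s)" by simp
  then show ?thesis using assms by (simp add: field_simps)
qed

text \<open>The three lengths that govern a typical shape, up to constants: \<^term>\<open>scale n\<close> is of order \<open>\<surd>n\<close>,
  \<open>arm n\<close> of order \<open>\<surd>n * ln n\<close> is exceeded by the first row and the first column, and a square of
  side \<open>side n\<close>, again of order \<open>\<surd>n\<close>, fits into the corner.\<close>

definition scale :: "nat \<Rightarrow> nat" where
  "scale n = nat \<lfloor>sqrt (real n) / 4\<rfloor>"

definition arm :: "nat \<Rightarrow> nat" where
  "arm n = nat \<lfloor>ln (real n) / 80\<rfloor> * scale n"

definition side :: "nat \<Rightarrow> nat" where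
  "side n = scale n div 256"

lemma scale_le: "real (scale n) \<le> sqrt (real n) / 4"
  unfolding scale_def by (rule of_nat_floor) simp

lemma scale_ge: "\<forall>\<^sub>F n in sequentially. sqrt (real n) / 5 \<le> real (scale n)"
proof -
  have "\<forall>\<^sub>F n in sequentially. sqrt (real n) / 5 \<le> sqrt (real n) / 4 - 1" by real_asymp
  then show ?thesis
  proof eventually_elim
    case (elim n)
    have "sqrt (real n) / 4 - 1 \<le> real (scale n)" unfolding scale_def by linarith
    with elim show ?case by linarith
  qed
qed

lemma arm_ge: "\<forall>\<^sub>F n in sequentially. sqrt (real n) * ln (real n) / 500 \<le> real (arm n)"
proof -
  have "\<forall>\<^sub>F n in sequentially. 0 \<le> ln (real n) \<and> ln (real n) / 100 \<le> ln (real n) / 80 - 1"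
    by (intro eventually_conj) real_asymp+
  with scale_ge show ?thesis
  proof eventually_elim
    case (elim n)
    have "ln (real n) / 100 \<le> real (nat \<lfloor>ln (real n) / 80\<rfloor>)" using elim by linarith
    then have "(ln (real n) / 100) * (sqrt (real n) / 5) \<le> real (nat \<lfloor>ln (real n) / 80\<rfloor>) * real (scale n)"
      using elim by (intro mult_mono) auto
    then show ?case by (simp add: arm_def algebra_simps)
  qed
qed

lemma two_power_scale_le: "2 ^ scale n \<le> pcount {1..} (int n)"
proof (cases "n = 0")
  case True
  then show ?thesis using pcount_zero_pos[of "{1..}"] by (simp add: scale_def)
next
  case False
  then obtain r where r: "0 < r" "2 * n \<le> r\<^sup>2" "r\<^sup>2 \<le> 4 * n" using square_between by blast
  have "(real (scale n))\<^sup>2 \<le> (sqrt (real n) / 4)\<^sup>2" by (intro power_mono scale_le) simp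
  then have "real (16 * (scale n)\<^sup>2) \<le> real n" by (simp add: power_divide)
  then have "16 * (scale n)\<^sup>2 \<le> n" by (simp only: of_nat_le_iff)
  then have "(4 * n) * (4 * (scale n)\<^sup>2) \<le> n * n" by simp
  moreover have "r\<^sup>2 * (4 * (scale n)\<^sup>2) \<le> (4 * n) * (4 * (scale n)\<^sup>2)" by (rule mult_right_mono[OF r(3)]) simp
  ultimately have "r\<^sup>2 * (4 * (scale n)\<^sup>2) \<le> n\<^sup>2" by (simp only: power2_eq_square[of n])
  then have "(2 * r * scale n)\<^sup>2 \<le> n\<^sup>2" by (simp add: power_mult_distrib mult_ac)
  then have "2 * r * scale n \<le> n" by (simp add: power2_nat_le_eq_le)
  with r show ?thesis by (intro pcount_ge_power)
qed

text \<open>With \<open>8192 < exp 10\<close>, the loss \<open>8192^(2 L)\<close> in \<open>few_small_part_partitions\<close> is at most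
  \<open>exp (20 L) \<le> n^(1/4)\<close> for \<open>L \<le> ln n / 80\<close>, while the gain is more than \<open>n^(1/2)\<close>.\<close>

lemma small_parts_rare:
  "\<forall>\<^sub>F n in sequentially. real (pcount {1..arm n} (int n)) * ln (real n) \<le> real (pcount {1..} (int n))"
proof -
  have "\<forall>\<^sub>F n in sequentially. 500 * exp (ln (real n) / 4) \<le> sqrt (real n)
      \<and> 2000 \<le> ln (real n) \<and> ln (real n) \<le> sqrt (real n)"
    by (intro eventually_conj) real_asymp+
  with scale_ge arm_ge show ?thesis
  proof eventually_elim
    case (elim n)
    define m where "m = scale n"
    define L where "L = nat \<lfloor>ln (real n) / 80\<rfloor>"
    define S where "S = sqrt (real n)"
    define l where "l = ln (real n)"
    have armL: "arm n = L * m" by (simp add: arm_def L_def m_def)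
    have m: "S / 5 \<le> real m" "real m \<le> S / 4" using elim(1) scale_le[of n] by (auto simp: m_def S_def)
    have K: "S * l / 500 \<le> real (L * m)" using elim(2) unfolding armL S_def l_def by simp
    have e: "500 * exp (l / 4) \<le> S" "2000 \<le> l" "l \<le> S" using elim(3) by (auto simp: S_def l_def)
    have L: "real L \<le> l / 80" using e(2) unfolding L_def l_def by linarith
    have S2: "S\<^sup>2 = real n" by (simp add: S_def)
    have "S * 4 \<le> S * (l / 500)" using e by (intro mult_left_mono) auto
    then have K4: "4 * S \<le> real (L * m)" using K by simp
    then have "(4 * S)\<^sup>2 \<le> (real (L * m))\<^sup>2" using e by (intro power_mono) auto
    then have "real (16 * n) \<le> real ((L * m)\<^sup>2)" by (simp add: power_mult_distrib S2)
    then have h1: "16 * n \<le> (L * m)\<^sup>2" by (simp only: of_nat_le_iff)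
    have "(real m)\<^sup>2 \<le> (S / 4)\<^sup>2" using m by (intro power_mono) auto
    then have a: "4 * (real m)\<^sup>2 \<le> real n / 4" using S2 by (simp add: power_divide)
    have "real L * real m \<le> (l / 80) * (S / 4)" using L m e by (intro mult_mono) auto
    also have "\<dots> \<le> (S / 80) * (S / 4)" using e by (intro mult_right_mono) auto
    also have "\<dots> = real n / 320" using S2 by (simp add: power2_eq_square)
    finally have "2 * (real L * real m) \<le> real n / 2" by simp
    with a have "real (4 * m\<^sup>2 + 2 * L * m) \<le> real n" by simp
    then have h2: "4 * m\<^sup>2 + 2 * L * m \<le> n" by (simp only: of_nat_le_iff)
    have "0 < real m" using m(1) e by linarith
    then have h3: "0 < m" by simp
    define q where "q = real (pcount {1..L * m} (int n))"
    define p where "p = real (pcount {1..} (int n))"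
    have "real (L * m * pcount {1..L * m} (int n)) \<le> real (8192 ^ (2 * L) * pcount {1..} (int n))"
      using few_small_part_partitions[OF h1 h2 h3] by (simp only: of_nat_le_iff)
    then have "real (L * m) * q \<le> 8192 ^ (2 * L) * p" by (simp add: q_def p_def)
    also have "(8192::real) ^ (2 * L) \<le> exp (l / 4)"
    proof -
      have "(8192::real) = exp (13 * ln 2)" by (simp add: exp_of_nat_mult[of 13 "ln 2", simplified])
      also have "\<dots> \<le> exp 10" using ln2_le_25_over_36 by simp
      finally have "(8192::real) ^ (2 * L) \<le> exp 10 ^ (2 * L)" by (intro power_mono) auto
      also have "\<dots> = exp (real (2 * L) * 10)" by (rule exp_of_nat_mult[symmetric])
      also have "\<dots> \<le> exp (l / 4)" using L by simp
      finally show ?thesis .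
    qed
    finally have "real (L * m) * q \<le> exp (l / 4) * p" by (simp add: p_def mult_right_mono)
    moreover have "(exp (l / 4) * l) * q \<le> real (L * m) * q"
    proof (rule mult_right_mono)
      have "exp (l / 4) * l \<le> (S / 500) * l" using e by (intro mult_right_mono) auto
      then show "exp (l / 4) * l \<le> real (L * m)" using K by simp
    qed (simp add: q_def)
    ultimately have "(exp (l / 4) * l) * q \<le> exp (l / 4) * p" by linarith
    then have "exp (l / 4) * (q * l) \<le> exp (l / 4) * p" by (simp only: mult_ac)
    then have "q * l \<le> p" by simp
    then show ?case by (simp add: q_def p_def l_def armL)
  qed
qed

text \<open>The number of thin partitions is at most \<open>exp (c * scale n)\<close>, up to a factor \<open>n + 1\<close>, where the
  constant \<open>c\<close> stays below \<open>ln 2\<close> because \<^const>\<open>side\<close> is a small fraction of \<^const>\<open>scale\<close>. All partitions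
  together number at least \<open>2^(scale n)\<close>.\<close>

lemma thin_rare:
  "\<forall>\<^sub>F n in sequentially.
     real (card {M \<in> parts_in {1..} (int n). size (filter_mset (\<lambda>x. side n < x) M) \<le> side n}) * ln (real n)
       \<le> real (pcount {1..} (int n))"
proof -
  have "\<forall>\<^sub>F n in sequentially. (real n + 1) * ln (real n) \<le> exp (7 / 100 * sqrt (real n))
      \<and> 2550 \<le> sqrt (real n) \<and> 1 \<le> ln (real n)"
    by (intro eventually_conj) real_asymp+
  with scale_ge show ?thesis
  proof eventually_elim
    case (elim n)
    define m where "m = scale n"
    define s where "s = side n"
    \<comment> \<open>The generating function is evaluated with N = u s = 2^17 s, about 512 times the scale m.\<close>
    define u :: nat where "u = 131072"
    define T where "T = real (card {M \<in> parts_in {1..} (int n). size (filter_mset (\<lambda>x. s < x) M) \<le> s})"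
    define p where "p = real (pcount {1..} (int n))"
    have m: "sqrt (real n) \<le> 5 * real m" using elim(1) by (simp add: m_def)
    have m510: "real m \<ge> 510" using m elim(2) by linarith
    have s1: "256 * s \<le> m" and s2: "m < 256 * s + 256" by (auto simp: s_def side_def m_def)
    have uN: "256 * m \<le> u * s" using s2 m510 unfolding u_def by linarith
    have u0: "0 < u * s" using uN m510 by linarith
    have "real n = (sqrt (real n))\<^sup>2" by simp
    also have "\<dots> \<le> (5 * real m)\<^sup>2" using m by (intro power_mono) auto
    finally have n: "real n \<le> 25 * (real m * real m)" by (simp add: power2_eq_square)
    have "(1 + 1 / real (u * s)) ^ n \<le> exp (1 / real (u * s)) ^ n"
      by (intro power_mono exp_ge_add_one_self) simp
    also have "\<dots> = exp (real n * (1 / real (u * s)))" by (rule exp_of_nat_mult[symmetric])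
    also have "\<dots> \<le> exp (real m / 10)"
    proof -
      have "real n \<le> real m / 10 * (256 * real m)" using n by (simp add: mult_nonneg_nonneg)
      also have "\<dots> \<le> real m / 10 * real (u * s)"
      proof (rule mult_left_mono)
        have "real (256 * m) \<le> real (u * s)" using uN by (simp only: of_nat_le_iff)
        then show "256 * real m \<le> real (u * s)" by simp
      qed simp
      finally have "real n \<le> real m / 10 * real (u * s)" .
      then have "real n / real (u * s) \<le> real m / 10" using u0 by (subst pos_divide_le_eq) simp_all
      then show ?thesis by simp
    qed
    finally have b1: "(1 + 1 / real (u * s)) ^ n \<le> exp (real m / 10)" .
    have "real ((u * s + s) choose s) \<le> real u ^ s * exp (2 * real s)"
      by (rule binomial_exp_bound) (simp add: u_def)
    also have "real u ^ s \<le> exp 12 ^ s"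
    proof (intro power_mono)
      have "real u = exp (17 * ln 2)" by (simp add: u_def exp_of_nat_mult[of 17 "ln 2", simplified])
      also have "\<dots> \<le> exp 12" using ln2_le_25_over_36 by simp
      finally show "real u \<le> exp 12" .
    qed simp
    also have "exp 12 ^ s * exp (2 * real s) = exp (14 * real s)"
      by (simp add: exp_of_nat_mult[symmetric] exp_add[symmetric])
    also have "\<dots> \<le> exp (real m * (11 / 200))" using s1 by simp
    finally have b2: "real ((u * s + s) choose s) \<le> exp (real m * (11 / 200))" by simp
    have "T \<le> real (n + 1) * ((1 + 1 / real (u * s)) ^ n * real ((u * s + s) choose s))\<^sup>2"
      unfolding T_def by (rule card_thin_le[OF u0])
    also have "\<dots> \<le> real (n + 1) * (exp (real m / 10) * exp (real m * (11 / 200)))\<^sup>2"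
      by (intro mult_left_mono power_mono mult_mono b1 b2) auto
    also have "\<dots> = real (n + 1) * exp (real m * (31 / 100))"
      by (simp add: exp_add[symmetric] exp_double[symmetric] algebra_simps)
    finally have "T * ln (real n) \<le> real (n + 1) * exp (real m * (31 / 100)) * ln (real n)"
      using elim(2) by (intro mult_right_mono) auto
    also have "\<dots> = ((real n + 1) * ln (real n)) * exp (real m * (31 / 100))" by (simp add: mult_ac)
    also have "\<dots> \<le> exp (35 / 100 * real m) * exp (real m * (31 / 100))"
    proof (rule mult_right_mono)
      have "exp (7 / 100 * sqrt (real n)) \<le> exp (35 / 100 * real m)" using m by simp
      with elim(2) show "(real n + 1) * ln (real n) \<le> exp (35 / 100 * real m)" by linarith
    qed simp
    also have "\<dots> = exp (real m * (66 / 100))" by (simp add: exp_add[symmetric] algebra_simps)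
    also have "\<dots> \<le> exp (real m * ln 2)"
    proof (subst exp_le_cancel_iff, rule mult_left_mono)
      show "66 / 100 \<le> ln (2 :: real)" using ln2_ge_two_thirds by linarith
    qed simp
    also have "\<dots> = real (2 ^ m)" by (simp add: exp_of_nat_mult)
    also have "\<dots> \<le> p" unfolding p_def m_def by (simp only: of_nat_le_iff two_power_scale_le)
    finally show ?case by (simp add: T_def s_def p_def)
  qed
qed

section \<open>An upper bound for packings of typical shapes\<close>

text \<open>The rectangle with corner \<open>v\<close> that extends by \<open>w\<close> horizontally and by \<open>h\<close> vertically, in the directions given by
  the signs \<open>\<sigma>\<close> and \<open>\<tau>\<close>.\<close>

definition oriented_rect :: "real \<Rightarrow> real \<Rightarrow> real \<times> real \<Rightarrow> real \<Rightarrow> real \<Rightarrow> (real \<times> real) set" where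
  "oriented_rect \<sigma> \<tau> v w h =
     {z. 0 \<le> \<sigma> * (fst z - fst v) \<and> \<sigma> * (fst z - fst v) \<le> w \<and>
         0 \<le> \<tau> * (snd z - snd v) \<and> \<tau> * (snd z - snd v) \<le> h}"

lemma rect_subset_ferrers_shape:
  assumes "0 < w" "0 < h" "h \<le> length xs" "\<And>i. i < h \<Longrightarrow> w \<le> xs ! i"
  shows "{0..real w} \<times> {0..real h} \<subseteq> ferrers_shape xs"
proof clarify
  have cell: "\<exists>j<k. x \<in> {real j..real j + 1}" if "0 < k" "x \<in> {0..real k}" for x :: real and k :: nat
  proof (cases "x < real k")
    case True
    have "0 \<le> x" using that by simp
    then have "real (nat \<lfloor>x\<rfloor>) \<le> x" "x < real (nat \<lfloor>x\<rfloor>) + 1" by linarith+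
    moreover from this True have "nat \<lfloor>x\<rfloor> < k" by linarith
    ultimately show ?thesis by (intro exI[of _ "nat \<lfloor>x\<rfloor>"]) auto
  next
    case False
    then have "x \<in> {real (k - 1)..real (k - 1) + 1}" using that by (auto simp: of_nat_diff)
    with that show ?thesis by (intro exI[of _ "k - 1"]) auto
  qed
  fix x y :: real assume "x \<in> {0..real w}" "y \<in> {0..real h}"
  with cell[of w x] cell[of h y] assms(1,2) obtain i j where
    "j < w" "x \<in> {real j..real j + 1}" "i < h" "y \<in> {real i..real i + 1}" by blast
  moreover from this assms have "i < length xs" "j < xs ! i" by (auto intro: less_le_trans)
  ultimately show "(x, y) \<in> ferrers_shape xs"
    unfolding ferrers_shape_def unit_box_def by blast
qed

text \<open>The isometries that exchange the axes swap width and height. For pairs of rectangles that are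
  symmetric under this exchange, only the signs \<open>\<sigma>, \<tau>\<close> and the position \<open>v\<close> of the apex matter.\<close>

lemma placement_contains_rects:
  assumes "is_placement xs R"
  obtains \<sigma> \<tau> v where "\<sigma> \<in> {1, -1}" "\<tau> \<in> {1, -1}"
    "\<And>w h. {0..w} \<times> {0..h} \<subseteq> ferrers_shape xs \<Longrightarrow> {0..h} \<times> {0..w} \<subseteq> ferrers_shape xs
       \<Longrightarrow> oriented_rect \<sigma> \<tau> v w h \<subseteq> R"
proof -
  obtain f v where f: "f \<in> axis_isometries" and R: "R = (\<lambda>z. v + f z) ` ferrers_shape xs"
    using assms unfolding is_placement_def by blast
  obtain s t :: real where st: "s \<in> {1, -1}" "t \<in> {1, -1}"
    and f_cases: "f = (\<lambda>(x, y). (s * x, t * y)) \<or> f = (\<lambda>(x, y). (s * y, t * x))"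
    using f unfolding axis_isometries_def by blast
  have sq: "s * (s * x) = x" "t * (t * x) = x" for x using st by auto
  have "oriented_rect s t v w h \<subseteq> R"
    if F: "{0..w} \<times> {0..h} \<subseteq> ferrers_shape xs" "{0..h} \<times> {0..w} \<subseteq> ferrers_shape xs" for w h
  proof
    fix z assume z: "z \<in> oriented_rect s t v w h"
    define x y where "x = s * (fst z - fst v)" and "y = t * (snd z - snd v)"
    have xy: "(x, y) \<in> {0..w} \<times> {0..h}" "(y, x) \<in> {0..h} \<times> {0..w}"
      using z by (auto simp: oriented_rect_def x_def y_def)
    have zz: "z = v + (s * x, t * y)"
      by (cases z; cases v) (simp add: x_def y_def sq)
    from f_cases show "z \<in> R"
    proof
      assume "f = (\<lambda>(x, y). (s * x, t * y))"
      then have "z = v + f (x, y)" using zz by simp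
      moreover have "(x, y) \<in> ferrers_shape xs" using xy F by blast
      ultimately show ?thesis unfolding R by blast
    next
      assume "f = (\<lambda>(x, y). (s * y, t * x))"
      then have "z = v + f (y, x)" using zz by simp
      moreover have "(y, x) \<in> ferrers_shape xs" using xy F by blast
      ultimately show ?thesis unfolding R by blast
    qed
  qed
  with st show ?thesis by (rule that)
qed

lemma interior_oriented_rect:
  assumes "\<sigma> \<in> {1, -1}" "\<tau> \<in> {1, -1}" "oriented_rect \<sigma> \<tau> v w h \<subseteq> R"
    "\<sigma> * fst v < X" "X < \<sigma> * fst v + w" "\<tau> * snd v < Y" "Y < \<tau> * snd v + h"
  shows "(\<sigma> * X, \<tau> * Y) \<in> interior R"
proof (rule interiorI)
  let ?O = "{z. \<sigma> * fst v < \<sigma> * fst z} \<inter> {z. \<sigma> * fst z < \<sigma> * fst v + w} \<inter>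
    {z. \<tau> * snd v < \<tau> * snd z} \<inter> {z. \<tau> * snd z < \<tau> * snd v + h} :: (real \<times> real) set"
  show "open ?O" by (intro open_Int open_Collect_less continuous_intros)
  have "\<sigma> * (\<sigma> * X) = X" "\<tau> * (\<tau> * Y) = Y" using assms(1,2) by auto
  then show "(\<sigma> * X, \<tau> * Y) \<in> ?O"
    using assms(4-7) by (simp only: Int_iff mem_Collect_eq fst_conv snd_conv simp_thms)
  have "?O \<subseteq> oriented_rect \<sigma> \<tau> v w h"
    by (auto simp: oriented_rect_def right_diff_distrib)
  with assms(3) show "?O \<subseteq> R" by blast
qed

lemma oriented_rects_overlap:
  assumes o: "\<sigma> \<in> {1, -1}" "\<tau> \<in> {1, -1}"
    and R: "oriented_rect \<sigma> \<tau> v w h \<subseteq> R" "oriented_rect \<sigma> \<tau> v' w' h' \<subseteq> R'"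
    and x: "\<bar>\<sigma> * fst v - \<sigma> * fst v'\<bar> < (if \<sigma> * fst v \<le> \<sigma> * fst v' then w else w')"
    and y: "\<bar>\<tau> * snd v - \<tau> * snd v'\<bar> < (if \<tau> * snd v \<le> \<tau> * snd v' then h else h')"
    and pos: "0 < w" "0 < h" "0 < w'" "0 < h'"
  shows "interior R \<inter> interior R' \<noteq> {}"
proof -
  have meet: "\<exists>x. a < x \<and> x < a + k \<and> a' < x \<and> x < a' + k'"
    if "\<bar>a - a'\<bar> < (if a \<le> a' then k else k')" "0 < k" "0 < k'" for a a' k k' :: real
  proof -
    have "max a a' < min (a + k) (a' + k')" using that by (auto split: if_splits simp: abs_if)
    then obtain x where "max a a' < x" "x < min (a + k) (a' + k')" using dense by blast
    then show ?thesis by auto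
  qed
  obtain X where X: "\<sigma> * fst v < X" "X < \<sigma> * fst v + w" "\<sigma> * fst v' < X" "X < \<sigma> * fst v' + w'"
    using meet[OF x pos(1,3)] by blast
  obtain Y where Y: "\<tau> * snd v < Y" "Y < \<tau> * snd v + h" "\<tau> * snd v' < Y" "Y < \<tau> * snd v' + h'"
    using meet[OF y pos(2,4)] by blast
  have "(\<sigma> * X, \<tau> * Y) \<in> interior R" using X Y by (intro interior_oriented_rect[OF o R(1)])
  moreover have "(\<sigma> * X, \<tau> * Y) \<in> interior R'" using X Y by (intro interior_oriented_rect[OF o R(2)])
  ultimately show ?thesis by blast
qed

text \<open>The only features of a typical shape on which the upper bound relies: two long arms and a square corner.\<close>

definition fat :: "nat \<Rightarrow> nat \<Rightarrow> nat list \<Rightarrow> bool" where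
  "fat D s xs \<longleftrightarrow> D \<le> length xs \<and> D \<le> xs ! 0 \<and> s \<le> length xs \<and> (\<forall>i<s. s \<le> xs ! i)"

definition fat_region :: "nat \<Rightarrow> nat \<Rightarrow> (real \<times> real) set \<Rightarrow> real \<Rightarrow> real \<Rightarrow> real \<times> real \<Rightarrow> bool" where
  "fat_region D s R \<sigma> \<tau> v \<longleftrightarrow> \<sigma> \<in> {1, -1} \<and> \<tau> \<in> {1, -1} \<and>
     oriented_rect \<sigma> \<tau> v (real D) 1 \<subseteq> R \<and> oriented_rect \<sigma> \<tau> v 1 (real D) \<subseteq> R \<and>
     oriented_rect \<sigma> \<tau> v (real s) (real s) \<subseteq> R"

lemma fat_placement:
  assumes "is_placement xs R" "fat D s xs" "\<forall>x\<in>set xs. 0 < x" "0 < D" "0 < s"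
  shows "\<exists>\<sigma> \<tau> v. fat_region D s R \<sigma> \<tau> v"
proof -
  have 1: "{0..real D} \<times> {0..real 1} \<subseteq> ferrers_shape xs"
    using assms by (intro rect_subset_ferrers_shape) (auto simp: fat_def)
  have 2: "{0..real 1} \<times> {0..real D} \<subseteq> ferrers_shape xs"
    using assms by (intro rect_subset_ferrers_shape) (auto simp: fat_def Suc_le_eq)
  have 3: "{0..real s} \<times> {0..real s} \<subseteq> ferrers_shape xs"
    using assms by (intro rect_subset_ferrers_shape) (auto simp: fat_def)
  show ?thesis
    using assms(1)
  proof (rule placement_contains_rects)
    fix \<sigma> \<tau> v
    assume "\<sigma> \<in> {1, -1}" "\<tau> \<in> {1, -1}" and
      "\<And>w h. {0..w} \<times> {0..h} \<subseteq> ferrers_shape xs \<Longrightarrow> {0..h} \<times> {0..w} \<subseteq> ferrers_shape xs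
         \<Longrightarrow> oriented_rect \<sigma> \<tau> v w h \<subseteq> R"
    from this(1,2) this(3)[of "real D" 1] this(3)[of 1 "real D"] this(3)[OF 3 3] 1 2
    have "fat_region D s R \<sigma> \<tau> v" by (simp add: fat_region_def)
    then show ?thesis by blast
  qed
qed

text \<open>Two shapes with the same orientation and nearby apexes cannot be disjoint if the apexes are also
  close along the diagonal. Let the second apex be ahead in the first direction. If it is not ahead
  in the second direction, then the horizontal arm of the first shape crosses the vertical arm of
  the second. If it is ahead in both directions, then closeness along the diagonal makes the corner
  squares overlap.\<close>

lemma fat_overlap_ordered:
  fixes D s :: nat
  assumes fat: "fat_region D s R \<sigma> \<tau> v" "fat_region D s R' \<sigma> \<tau> v'"
    and pos: "0 < D" "0 < s"
    and le: "\<sigma> * fst v \<le> \<sigma> * fst v'"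
    and box: "\<bar>\<sigma> * fst v - \<sigma> * fst v'\<bar> < real D" "\<bar>\<tau> * snd v - \<tau> * snd v'\<bar> < real D"
    and diag: "\<bar>(\<sigma> * fst v + \<tau> * snd v) - (\<sigma> * fst v' + \<tau> * snd v')\<bar> < real s"
  shows "interior R \<inter> interior R' \<noteq> {}"
proof -
  note o = fat(1)[unfolded fat_region_def, THEN conjunct1]
    fat(1)[unfolded fat_region_def, THEN conjunct2, THEN conjunct1]
  have R: "oriented_rect \<sigma> \<tau> v (real D) 1 \<subseteq> R" "oriented_rect \<sigma> \<tau> v (real s) (real s) \<subseteq> R"
    and R': "oriented_rect \<sigma> \<tau> v' 1 (real D) \<subseteq> R'" "oriented_rect \<sigma> \<tau> v' (real s) (real s) \<subseteq> R'"
    using fat by (simp_all only: fat_region_def)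
  show ?thesis
  proof (cases "\<tau> * snd v' \<le> \<tau> * snd v")
    case True
    show ?thesis
      by (rule oriented_rects_overlap[OF o R(1) R'(1)]) (use True le box pos in \<open>auto split: if_splits\<close>)
  next
    case False
    show ?thesis
      by (rule oriented_rects_overlap[OF o R(2) R'(2)]) (use False le diag pos in \<open>auto split: if_splits\<close>)
  qed
qed

lemma floor_eq_imp_close:
  fixes x y d :: real
  assumes "\<lfloor>x / d\<rfloor> = \<lfloor>y / d\<rfloor>" "0 < d"
  shows "\<bar>x - y\<bar> < d"
proof -
  have "\<bar>x / d - y / d\<bar> < 1" using assms(1) by linarith
  then have "\<bar>(x - y) / d\<bar> < 1" by (simp add: diff_divide_distrib)
  then show ?thesis using assms(2) by (simp add: abs_divide)
qed

text \<open>The apexes are sorted by orientation and by boxes of side \<open>D\<close>. Within a box the values of the sum of the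
  (signed) coordinates lie in an interval of length \<open>2 D\<close> and are at least \<open>s\<close> apart, so that the box
  contains \<open>O(D / s)\<close> apexes. Since there are \<open>O(n p / D\<^sup>2)\<close> boxes, each shape takes up an area of
  order \<open>D s\<close> on average.\<close>

lemma card_fat_packing:
  fixes n p D s :: nat
  assumes S: "finite S" "\<forall>xs\<in>S. fat D s xs \<and> (\<forall>x\<in>set xs. 0 < x)"
    and P: "\<forall>xs\<in>S. is_placement xs (P xs) \<and> P xs \<subseteq> {0..real n} \<times> {0..real p}"
    and disj: "disjoint_family_on (\<lambda>xs. interior (P xs)) S"
    and D: "0 < s" "s \<le> D" "D \<le> n" "D \<le> p"
  shows "real (card S) \<le> 300 * real n * real p / (real D * real s)"
proof -
  have "\<exists>\<sigma> \<tau> v. fat_region D s (P xs) \<sigma> \<tau> v" if "xs \<in> S" for xs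
  proof (rule fat_placement)
    show "is_placement xs (P xs)" using P that by blast
    show "fat D s xs" "\<forall>x\<in>set xs. 0 < x" using S(2) that by blast+
  qed (use D in linarith)+
  then obtain \<sigma> \<tau> v where fat: "\<And>xs. xs \<in> S \<Longrightarrow> fat_region D s (P xs) (\<sigma> xs) (\<tau> xs) (v xs)"
    by metis
  have o: "\<sigma> xs \<in> {1, -1}" "\<tau> xs \<in> {1, -1}" if "xs \<in> S" for xs
    using fat[OF that] by (simp_all only: fat_region_def)
  define a where "a xs = \<sigma> xs * fst (v xs)" for xs
  define b where "b xs = \<tau> xs * snd (v xs)" for xs
  \<comment> \<open>The box of an apex, and its position along the diagonal of that box.\<close>
  define i where "i xs = \<lfloor>a xs / real D\<rfloor>" for xs
  define j where "j xs = \<lfloor>b xs / real D\<rfloor>" for xs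
  define k where "k xs = \<lfloor>(a xs + b xs - real_of_int (i xs + j xs) * real D) / real s\<rfloor>" for xs
  define key where "key xs = (\<sigma> xs, \<tau> xs, i xs, j xs, k xs)" for xs
  have D0: "0 < real D" "0 < real s" using D by auto
  have "inj_on key S"
  proof (rule inj_onI, rule ccontr)
    fix xs ys assume xs: "xs \<in> S" and ys: "ys \<in> S" and "key xs = key ys" and ne: "xs \<noteq> ys"
    then have eq: "\<sigma> ys = \<sigma> xs" "\<tau> ys = \<tau> xs" "i xs = i ys" "j xs = j ys" "k xs = k ys"
      by (auto simp: key_def)
    have box: "\<bar>a xs - a ys\<bar> < real D" "\<bar>b xs - b ys\<bar> < real D"
      using eq(3,4) D0 unfolding i_def j_def by (auto intro: floor_eq_imp_close)
    have "\<bar>(a xs + b xs - real_of_int (i xs + j xs) * real D)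
        - (a ys + b ys - real_of_int (i ys + j ys) * real D)\<bar> < real s"
      using eq(5) D0(2) unfolding k_def by (rule floor_eq_imp_close)
    then have diag: "\<bar>(a xs + b xs) - (a ys + b ys)\<bar> < real s" using eq(3,4) by simp
    have box': "\<bar>a ys - a xs\<bar> < real D" "\<bar>b ys - b xs\<bar> < real D"
      and diag': "\<bar>(a ys + b ys) - (a xs + b xs)\<bar> < real s"
      using box diag by (simp_all add: abs_minus_commute)
    have Dn: "0 < D" using D by simp
    note fx = fat[OF xs] and fy = fat[OF ys, unfolded eq(1,2)]
    have "interior (P xs) \<inter> interior (P ys) \<noteq> {}"
    proof (cases "a xs \<le> a ys")
      case True
      show ?thesis
        using fat_overlap_ordered[OF fx fy Dn D(1)] True box diag
        by (simp add: a_def b_def eq)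
    next
      case False
      have "interior (P ys) \<inter> interior (P xs) \<noteq> {}"
        using fat_overlap_ordered[OF fy fx Dn D(1)] False box' diag'
        by (simp add: a_def b_def eq)
      then show ?thesis by blast
    qed
    moreover have "interior (P xs) \<inter> interior (P ys) = {}"
      using disj xs ys ne by (auto simp: disjoint_family_on_def)
    ultimately show False by blast
  qed
  define I where "I = {- (\<lfloor>real n / real D\<rfloor> + 1)..\<lfloor>real n / real D\<rfloor> + 1}"
  define J where "J = {- (\<lfloor>real p / real D\<rfloor> + 1)..\<lfloor>real p / real D\<rfloor> + 1}"
  define Kset where "Kset = {0..\<lfloor>2 * real D / real s\<rfloor>}"
  let ?X = "{1, -1 :: real} \<times> {1, -1 :: real} \<times> I \<times> J \<times> Kset"
  have floor_range: "\<lfloor>x / real D\<rfloor> \<in> {- (\<lfloor>real l / real D\<rfloor> + 1)..\<lfloor>real l / real D\<rfloor> + 1}"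
    if "\<bar>x\<bar> \<le> real l" for x l
  proof -
    have "\<bar>x\<bar> / real D \<le> real l / real D" using that by (rule divide_right_mono) simp
    then have "\<bar>x / real D\<bar> \<le> real l / real D" by (simp add: abs_divide)
    then show ?thesis unfolding atLeastAtMost_iff by linarith
  qed
  have "key ` S \<subseteq> ?X"
  proof (rule image_subsetI)
    fix xs assume xs: "xs \<in> S"
    have "v xs \<in> oriented_rect (\<sigma> xs) (\<tau> xs) (v xs) (real D) 1" by (simp add: oriented_rect_def)
    moreover have "oriented_rect (\<sigma> xs) (\<tau> xs) (v xs) (real D) 1 \<subseteq> P xs"
      using fat[OF xs] by (simp only: fat_region_def)
    ultimately have "v xs \<in> {0..real n} \<times> {0..real p}" using P xs by blast
    then have "\<bar>fst (v xs)\<bar> \<le> real n" "\<bar>snd (v xs)\<bar> \<le> real p" by (auto simp: mem_Times_iff)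
    then have "\<bar>a xs\<bar> \<le> real n" "\<bar>b xs\<bar> \<le> real p"
      using o[OF xs] by (auto simp: a_def b_def abs_mult)
    then have "i xs \<in> I" "j xs \<in> J" unfolding i_def j_def I_def J_def by (auto simp only: floor_range)
    moreover have "k xs \<in> Kset"
    proof -
      have near: "real_of_int \<lfloor>x / real D\<rfloor> * real D \<le> x" "x \<le> real_of_int \<lfloor>x / real D\<rfloor> * real D + real D" for x
      proof -
        have "real_of_int \<lfloor>x / real D\<rfloor> \<le> x / real D" "x / real D \<le> real_of_int \<lfloor>x / real D\<rfloor> + 1" by linarith+
        then have "real_of_int \<lfloor>x / real D\<rfloor> * real D \<le> x"
          "x \<le> (real_of_int \<lfloor>x / real D\<rfloor> + 1) * real D"
          using D0(1) by (simp_all only: pos_le_divide_eq pos_divide_le_eq)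
        then show "real_of_int \<lfloor>x / real D\<rfloor> * real D \<le> x" "x \<le> real_of_int \<lfloor>x / real D\<rfloor> * real D + real D"
          using D0 by (simp_all add: distrib_right)
      qed
      define d where "d = a xs + b xs - real_of_int (i xs + j xs) * real D"
      have "0 \<le> d" "d \<le> 2 * real D"
        using near[of "a xs"] near[of "b xs"] unfolding d_def i_def j_def by (simp_all add: distrib_right)
      then have "0 \<le> d / real s" "d / real s \<le> 2 * real D / real s"
        by (auto intro: divide_right_mono)
      then show ?thesis unfolding k_def d_def[symmetric] Kset_def atLeastAtMost_iff
        by (auto intro: floor_mono)
    qed
    ultimately show "key xs \<in> ?X" using o[OF xs] by (simp add: key_def)
  qed
  then have "card S \<le> card ?X"
    using \<open>inj_on key S\<close> by (intro card_inj_on_le[of key]) (auto simp: I_def J_def Kset_def)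
  also have "card ?X = 4 * card I * card J * card Kset" by (simp add: card_cartesian_product)
  finally have "real (card S) \<le> real (4 * card I * card J * card Kset)" by (simp only: of_nat_le_iff)
  also have "\<dots> = 4 * real (card I) * real (card J) * real (card Kset)" by simp
  also have "\<dots> \<le> 4 * (5 * real n / real D) * (5 * real p / real D) * (3 * real D / real s)"
  proof -
    have range: "real (card {- (\<lfloor>real l / real D\<rfloor> + 1)..\<lfloor>real l / real D\<rfloor> + 1}) \<le> 5 * real l / real D"
      if "D \<le> l" for l
    proof -
      have "1 \<le> real l / real D" using that D0 by simp
      moreover have "real (card {- (\<lfloor>real l / real D\<rfloor> + 1)..\<lfloor>real l / real D\<rfloor> + 1}) \<le> 2 * (real l / real D) + 3"
        using calculation by simp linarith
      ultimately have "real (card {- (\<lfloor>real l / real D\<rfloor> + 1)..\<lfloor>real l / real D\<rfloor> + 1}) \<le> 5 * (real l / real D)"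
        by linarith
      then show ?thesis by simp
    qed
    have "1 \<le> real D / real s" using D D0 by simp
    then have "real (card Kset) \<le> 3 * (real D / real s)" unfolding Kset_def by simp linarith
    then have "real (card Kset) \<le> 3 * real D / real s" by simp
    then show ?thesis using range[OF D(3)] range[OF D(4)] unfolding I_def J_def
      by (intro mult_mono) auto
  qed
  also have "\<dots> = 300 * real n * real p / (real D * real s)"
    using D0 by (simp add: field_simps)
  finally show ?thesis .
qed

section \<open>A packing along diagonals\<close>

definition placed :: "nat \<Rightarrow> nat \<Rightarrow> nat list \<Rightarrow> (real \<times> real) set" where
  "placed a b xs = (\<lambda>z. (real a, real b) + z) ` ferrers_shape xs"

definition cells :: "nat \<Rightarrow> nat \<Rightarrow> nat list \<Rightarrow> (nat \<times> nat) set" where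
  "cells a b xs = {(a + l, b + k) | k l. k < length xs \<and> l < xs ! k}"

lemma is_placement_placed: "is_placement xs (placed a b xs)"
proof -
  have "(\<lambda>(x, y). (1 * x, 1 * y)) \<in> axis_isometries" unfolding axis_isometries_def by blast
  moreover have "(\<lambda>(x, y). (1 * x, 1 * y)) = (\<lambda>z :: real \<times> real. z)" by (auto simp: fun_eq_iff)
  ultimately have "(\<lambda>z. z) \<in> axis_isometries" by simp
  then show ?thesis unfolding is_placement_def placed_def
    by (intro bexI[of _ "\<lambda>z. z"] exI[of _ "(real a, real b)"]) auto
qed

lemma mem_placedE:
  assumes "(x, y) \<in> placed a b xs"
  obtains k l where "(a + l, b + k) \<in> cells a b xs" "k < length xs" "l < xs ! k"
    "real (a + l) \<le> x" "x \<le> real (a + l) + 1" "real (b + k) \<le> y" "y \<le> real (b + k) + 1"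
proof -
  obtain u v where uv: "(u, v) \<in> ferrers_shape xs" "x = real a + u" "y = real b + v"
    using assms unfolding placed_def by auto
  then obtain k l where "k < length xs" "l < xs ! k" "(u, v) \<in> unit_box k l"
    unfolding ferrers_shape_def by blast
  with uv show ?thesis by (intro that[of l k]) (auto simp: cells_def unit_box_def)
qed

text \<open>A nonempty open set contains a point with two coordinates that are not integers, and such a point lies in only one
  cell of the integer grid.\<close>

lemma disjoint_cells_imp_disjoint_interiors:
  assumes "cells a b xs \<inter> cells a' b' ys = {}"
  shows "interior (placed a b xs) \<inter> interior (placed a' b' ys) = {}"
proof (rule ccontr)
  let ?U = "interior (placed a b xs) \<inter> interior (placed a' b' ys)"
  assume "?U \<noteq> {}"
  then obtain z where z: "z \<in> ?U" by blast
  have "open ?U" by (intro open_Int open_interior)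
  from open_prod_elim[OF this z] obtain A B where
    AB: "open A" "open B" "z \<in> A \<times> B" "A \<times> B \<subseteq> ?U" by blast
  have nonint: "\<exists>x\<in>T. real_of_int \<lfloor>x\<rfloor> < x" if T: "open T" "x0 \<in> T" for T :: "real set" and x0
  proof -
    obtain e where e: "e > 0" "\<And>y. dist y x0 < e \<Longrightarrow> y \<in> T" using T open_dist by metis
    have "x0 < min (x0 + e) (real_of_int \<lfloor>x0\<rfloor> + 1)" using e(1) by simp
    then obtain x where x: "x0 < x" "x < min (x0 + e) (real_of_int \<lfloor>x0\<rfloor> + 1)" using dense by blast
    then have "x \<in> T" using e(2)[of x] by (simp add: dist_real_def)
    moreover have "\<lfloor>x\<rfloor> = \<lfloor>x0\<rfloor>" using x by linarith
    moreover have "real_of_int \<lfloor>x0\<rfloor> < x" using x by linarith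
    ultimately show ?thesis by (intro bexI[of _ x]) (simp_all only:)
  qed
  obtain x where x: "x \<in> A" "real_of_int \<lfloor>x\<rfloor> < x" using nonint[of A "fst z"] AB by (auto simp: mem_Times_iff)
  obtain y where y: "y \<in> B" "real_of_int \<lfloor>y\<rfloor> < y" using nonint[of B "snd z"] AB by (auto simp: mem_Times_iff)
  have "(x, y) \<in> ?U" using x y AB by blast
  then have xy: "(x, y) \<in> placed a b xs" "(x, y) \<in> placed a' b' ys"
    using interior_subset by blast+
  have unique: "m = nat \<lfloor>x\<rfloor>" if "real m \<le> x" "x \<le> real m + 1" "real_of_int \<lfloor>x\<rfloor> < x" for m x
  proof -
    have "x \<noteq> real m + 1" using that(3) by (metis floor_of_nat less_irrefl of_int_of_nat_eq of_nat_Suc add.commute)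
    then have "x < real m + 1" using that(2) by simp
    then show ?thesis using that(1) by linarith
  qed
  have "(nat \<lfloor>x\<rfloor>, nat \<lfloor>y\<rfloor>) \<in> cells a b xs"
    using xy(1) by (rule mem_placedE) (use unique x(2) y(2) in metis)
  moreover have "(nat \<lfloor>x\<rfloor>, nat \<lfloor>y\<rfloor>) \<in> cells a' b' ys"
    using xy(2) by (rule mem_placedE) (use unique x(2) y(2) in metis)
  ultimately show False using assms by blast
qed

text \<open>A cell outside both strips would force \<open>(r + 1)\<^sup>2\<close> cells below it.\<close>

lemma partition_cell_near_axis:
  assumes xs: "xs \<in> partitions n" and n: "n < (r + 1)\<^sup>2" and k: "k < length xs" "l < xs ! k"
  shows "k < r \<or> l < r"
proof (rule ccontr)
  assume "\<not> (k < r \<or> l < r)"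
  then have kl: "r \<le> k" "r \<le> l" by auto
  have big: "r + 1 \<le> x" if x: "x \<in> set (take (r + 1) xs)" for x
  proof -
    obtain i where i: "i < r + 1" "i < length xs" "x = xs ! i"
      using x unfolding in_set_conv_nth by force
    have "xs ! k \<le> xs ! i"
    proof (cases "i = k")
      case False
      then have "i < k" using i kl by simp
      with xs k show ?thesis unfolding partitions_def by (auto simp: sorted_wrt_iff_nth_less)
    qed simp
    with i k kl show ?thesis by simp
  qed
  have "(r + 1) * length (take (r + 1) xs) = sum_list (map (\<lambda>_. r + 1) (take (r + 1) xs))"
    by (simp add: sum_list_triv)
  also have "\<dots> \<le> sum_list (map (\<lambda>x. x) (take (r + 1) xs))" using big by (intro sum_list_mono)
  also have "\<dots> \<le> sum_list (take (r + 1) xs) + sum_list (drop (r + 1) xs)" by simp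
  also have "\<dots> = sum_list xs" by (metis append_take_drop_id sum_list_append)
  also have "\<dots> = n" using xs by (simp add: partitions_def)
  finally show False using n k kl by (simp add: power2_eq_square)
qed

text \<open>The apexes are shifted by multiples of \<open>r\<close> along a diagonal, and the diagonals are \<open>2 W\<close> apart. Cells
  of shapes on different diagonals differ in the difference of their coordinates. On the same
  diagonal, a later shape lies in the quadrant at distance \<open>r\<close> from the axes of an earlier shape, which
  the earlier shape does not enter.\<close>

lemma diagonal_slots_disjoint:
  assumes xs: "xs \<in> partitions n" "length xs \<le> W" "\<forall>x\<in>set xs. x \<le> W"
    and ys: "ys \<in> partitions n" "length ys \<le> W" "\<forall>y\<in>set ys. y \<le> W"
    and n: "n < (r + 1)\<^sup>2" and ne: "(i, j) \<noteq> (i', j')"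
  shows "cells (i * r) (i * r + 2 * W * j) xs \<inter> cells (i' * r) (i' * r + 2 * W * j') ys = {}"
proof (rule ccontr)
  assume "\<not> ?thesis"
  then obtain k l k' l' where
    kl: "k < length xs" "l < xs ! k" "k' < length ys" "l' < ys ! k'"
    and eq: "i * r + l = i' * r + l'" "i * r + 2 * W * j + k = i' * r + 2 * W * j' + k'"
    unfolding cells_def by auto
  have "xs ! k \<le> W" "ys ! k' \<le> W" using kl xs(3) ys(3) by auto
  then have W: "k < W" "l < W" "k' < W" "l' < W" using kl xs(2) ys(2) by linarith+
  have "W * (2 * j) + k + l' = W * (2 * j') + k' + l"
    using eq by (simp add: mult_ac)
  moreover have False if "a < b" "W * (2 * a) + u = W * (2 * b) + v" "u < 2 * W" for a b u v
  proof -
    have "W * (2 * a + 2) \<le> W * (2 * b)" using that(1) by (intro mult_left_mono) auto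
    with that(2,3) show False by simp
  qed
  from this[of j j' "k + l'" "k' + l"] this[of j' j "k' + l" "k + l'"]
  have "j = j'" using calculation W by (cases j j' rule: linorder_cases) auto
  with eq have eq': "i * r + l = i' * r + l'" "i * r + k = i' * r + k'" by auto
  have False if "i < i'" "i * r + l = i' * r + l'" "i * r + k = i' * r + k'" "k < r \<or> l < r"
    for i i' k l k' l'
  proof -
    have "(i + 1) * r \<le> i' * r" using that(1) by (intro mult_right_mono) auto
    with that show False by simp
  qed
  from this[of i i' l l' k k'] this[of i' i l' l k' k]
  have "i = i'" using eq' partition_cell_near_axis[OF xs(1) n kl(1,2)] partition_cell_near_axis[OF ys(1) n kl(3,4)]
    by (cases i i' rule: linorder_cases) auto
  with \<open>j = j'\<close> ne show False by simp
qed

lemma placed_subset_rectangle: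
  assumes "length xs \<le> W" "\<forall>x\<in>set xs. x \<le> W" "a + W \<le> n" "b + W \<le> p"
  shows "placed a b xs \<subseteq> {0..real n} \<times> {0..real p}"
proof clarify
  fix x y assume "(x, y) \<in> placed a b xs"
  then obtain k l where kl: "k < length xs" "l < xs ! k" and
    xy: "real (a + l) \<le> x" "x \<le> real (a + l) + 1" "real (b + k) \<le> y" "y \<le> real (b + k) + 1"
    by (rule mem_placedE)
  have "xs ! k \<le> W" using kl assms(2) by simp
  then have "real (a + l + 1) \<le> real n" "real (b + k + 1) \<le> real p"
    using kl assms by (simp_all only: of_nat_le_iff)
  with xy show "x \<in> {0..real n} \<and> y \<in> {0..real p}"
    by (auto intro: order_trans[of 0 "real (a + l)"] order_trans[of 0 "real (b + k)"])
qed

lemma packable_bounded_partitions: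
  assumes S: "S \<subseteq> partitions n" "\<forall>xs\<in>S. length xs \<le> W \<and> (\<forall>x\<in>set xs. x \<le> W)"
    and card: "card S \<le> I * J" and n: "n < (r + 1)\<^sup>2"
    and fit: "I * r + W \<le> n" "I * r + 2 * W * J \<le> num_partitions n"
  shows "packable (partition_rectangle n) S"
proof -
  have "finite S" using S(1) finite_partitions by (rule finite_subset)
  moreover have "card S \<le> card ({..<I} \<times> {..<J})" using card by (simp add: card_cartesian_product)
  ultimately obtain f where f: "f ` S \<subseteq> {..<I} \<times> {..<J}" "inj_on f S"
    using card_le_inj[of S "{..<I} \<times> {..<J}"] by auto
  define P where "P xs = placed (fst (f xs) * r) (fst (f xs) * r + 2 * W * snd (f xs)) xs" for xs
  have "P xs \<subseteq> partition_rectangle n" if xs: "xs \<in> S" for xs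
    unfolding P_def partition_rectangle_def
  proof (rule placed_subset_rectangle)
    have slot: "fst (f xs) < I" "snd (f xs) < J" using f(1) xs by (auto simp: mem_Times_iff image_subset_iff)
    have 1: "fst (f xs) * r \<le> I * r" using slot by simp
    then show "fst (f xs) * r + W \<le> n" using fit(1) by linarith
    have "2 * W * (snd (f xs) + 1) \<le> 2 * W * J" using slot(2) by (intro mult_left_mono) auto
    then have "2 * W * snd (f xs) + 2 * W \<le> 2 * W * J" by simp
    then show "fst (f xs) * r + 2 * W * snd (f xs) + W \<le> num_partitions n" using 1 fit(2) by linarith
  qed (use S(2) xs in auto)
  moreover have "disjoint_family_on (\<lambda>xs. interior (P xs)) S"
    unfolding disjoint_family_on_def
  proof (intro ballI impI)
    fix xs ys assume xy: "xs \<in> S" "ys \<in> S" "xs \<noteq> ys"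
    then have "f xs \<noteq> f ys" using f(2) by (auto dest: inj_onD)
    then have ne: "(fst (f xs), snd (f xs)) \<noteq> (fst (f ys), snd (f ys))" by simp
    show "interior (P xs) \<inter> interior (P ys) = {}"
      unfolding P_def
      by (intro disjoint_cells_imp_disjoint_interiors diagonal_slots_disjoint[OF _ _ _ _ _ _ n ne])
         (use S xy in auto)
  qed
  moreover have "is_placement xs (P xs)" for xs unfolding P_def by (rule is_placement_placed)
  ultimately show ?thesis unfolding packable_def by blast
qed

section \<open>The order of magnitude\<close>

lemma card_partitions_mset:
  "card {xs \<in> partitions n. Q (mset xs)} = card {M \<in> parts_in {1..} (int n). Q M}"
proof -
  have "bij_betw mset {xs \<in> partitions n. Q (mset xs)} {M \<in> parts_in {1..} (int n). Q M}"
    using mset_partitions[of n] by (rule bij_betw_subset) (use mset_partitions[of n] in \<open>auto simp: bij_betw_def\<close>)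
  then show ?thesis by (rule bij_betw_same_card)
qed

text \<open>The corner square comes from the parts above \<open>s\<close>: if the part with index \<open>i < s\<close> were below \<open>s\<close>, then
  at most \<open>i\<close> parts could exceed \<open>s\<close>.\<close>

lemma fatI:
  assumes xs: "xs \<in> partitions n" and D: "D < size (mset xs)" "\<exists>x\<in>#mset xs. D < x"
    and s: "s < size (filter_mset (\<lambda>x. s < x) (mset xs))"
  shows "fat D s xs"
proof -
  have mono: "xs ! j \<le> xs ! i" if "i \<le> j" "j < length xs" for i j
    using xs that unfolding partitions_def
    by (cases "i = j") (auto simp: sorted_wrt_iff_nth_less)
  obtain j where "j < length xs" "D < xs ! j" using D(2) by (auto simp: in_set_conv_nth)
  then have "D \<le> xs ! 0" using mono[of 0 j] by simp
  moreover have len: "s < length (filter (\<lambda>x. s < x) xs)" using s by (simp flip: mset_filter)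
  have "s \<le> xs ! i" if i: "i < s" for i
  proof (rule ccontr)
    assume small: "\<not> s \<le> xs ! i"
    have "x \<le> s" if x: "x \<in> set (drop i xs)" for x
    proof -
      obtain j where j: "j < length (drop i xs)" "x = drop i xs ! j"
        using x unfolding in_set_conv_nth by blast
      then have "x \<le> xs ! i" using mono[of i "i + j"] by simp
      with small show ?thesis by simp
    qed
    then have "filter (\<lambda>x. s < x) (drop i xs) = []" by (auto simp: filter_empty_conv not_less)
    then have "filter (\<lambda>x. s < x) xs = filter (\<lambda>x. s < x) (take i xs)"
      by (metis append_Nil2 append_take_drop_id filter_append)
    then have "length (filter (\<lambda>x. s < x) xs) \<le> length (take i xs)"
      by (simp only: length_filter_le)
    with len i show False by simp
  qed
  moreover have "s \<le> length xs" using len length_filter_le[of "\<lambda>x. s < x" xs] by linarith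
  ultimately show ?thesis using D(1) by (simp add: fat_def)
qed

lemma card_not_fat:
  "card {xs \<in> partitions n. \<not> fat D s xs} \<le> 2 * pcount {1..D} (int n)
     + card {M \<in> parts_in {1..} (int n). size (filter_mset (\<lambda>x. s < x) M) \<le> s}"
proof -
  let ?Z = "{M \<in> parts_in {1..} (int n). size (filter_mset (\<lambda>x. s < x) M) \<le> s}"
  let ?Q = "\<lambda>M. size M \<le> D \<or> (\<forall>x\<in>#M. x \<le> D) \<or> size (filter_mset (\<lambda>x. s < x) M) \<le> s"
  have fin: "finite (parts_in {1..} (int n))" "finite (parts_in {1..D} (int n))" by (simp_all add: finite_parts_in)
  have "{xs \<in> partitions n. \<not> fat D s xs} \<subseteq> {xs \<in> partitions n. ?Q (mset xs)}"
  proof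
    fix xs assume xs: "xs \<in> {xs \<in> partitions n. \<not> fat D s xs}"
    have "?Q (mset xs)"
    proof (rule ccontr)
      assume "\<not> ?Q (mset xs)"
      then have "D < size (mset xs)" "\<exists>x\<in>#mset xs. D < x" "s < size (filter_mset (\<lambda>x. s < x) (mset xs))"
        unfolding de_Morgan_disj not_le by (blast, force simp: not_le, blast)
      with fatI[of xs n D s] xs show False by blast
    qed
    with xs show "xs \<in> {xs \<in> partitions n. ?Q (mset xs)}" by blast
  qed
  then have "card {xs \<in> partitions n. \<not> fat D s xs} \<le> card {xs \<in> partitions n. ?Q (mset xs)}"
    by (intro card_mono) (simp_all add: finite_partitions)
  also have "\<dots> = card {M \<in> parts_in {1..} (int n). ?Q M}" by (rule card_partitions_mset)
  also have "\<dots> \<le> card ({M \<in> parts_in {1..} (int n). size M \<le> D} \<union> parts_in {1..D} (int n) \<union> ?Z)"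
  proof (rule card_mono)
    show "finite ({M \<in> parts_in {1..} (int n). size M \<le> D} \<union> parts_in {1..D} (int n) \<union> ?Z)"
      using fin by simp
  qed (auto simp: parts_in_def)
  also have "\<dots> \<le> card {M \<in> parts_in {1..} (int n). size M \<le> D} + card (parts_in {1..D} (int n)) + card ?Z"
    using card_Un_le[of "{M \<in> parts_in {1..} (int n). size M \<le> D} \<union> parts_in {1..D} (int n)" ?Z]
      card_Un_le[of "{M \<in> parts_in {1..} (int n). size M \<le> D}" "parts_in {1..D} (int n)"] by linarith
  also have "\<dots> \<le> 2 * pcount {1..D} (int n) + card ?Z"
    using card_size_le[of n D] by (simp add: pcount_def)
  finally show ?thesis .
qed

lemma num_partitions_ge_linear: "\<forall>\<^sub>F n in sequentially. 128 * n \<le> num_partitions n"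
proof -
  have "\<forall>\<^sub>F n in sequentially. 128 * real n \<le> exp (2 / 15 * sqrt (real n))" by real_asymp
  with scale_ge show ?thesis
  proof eventually_elim
    case (elim n)
    have "2 / 15 * sqrt (real n) \<le> real (scale n) * (2 / 3)" using elim(1) by simp
    also have "\<dots> \<le> real (scale n) * ln 2" using ln2_ge_two_thirds by (intro mult_left_mono) auto
    finally have "exp (2 / 15 * sqrt (real n)) \<le> exp (real (scale n) * ln 2)" by simp
    also have "\<dots> = real (2 ^ scale n)" by (simp add: exp_of_nat_mult)
    also have "\<dots> \<le> real (num_partitions n)"
      unfolding num_partitions_eq by (simp only: of_nat_le_iff two_power_scale_le)
    finally have "real (128 * n) \<le> real (num_partitions n)" using elim(2) by simp
    then show ?case by (simp only: of_nat_le_iff)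
  qed
qed

text \<open>Partitions that are not fat contribute at most \<open>3 p(n) / ln n\<close> shapes, simply because there are no
  more of them. The fat ones take up an area of order \<open>\<surd>n * ln n\<close> times \<open>\<surd>n\<close> each.\<close>

lemma max_packing_upper:
  "\<forall>\<^sub>F n in sequentially. real (max_packing n) \<le> 300000003 * (real (num_partitions n) / ln (real n))"
proof -
  have "\<forall>\<^sub>F n in sequentially. sqrt (real n) / 2000 \<le> sqrt (real n) / 1280 - 1 \<and> 1 \<le> sqrt (real n) / 2000
      \<and> 500 \<le> ln (real n) \<and> ln (real n) \<le> sqrt (real n)"
    by (intro eventually_conj) real_asymp+
  with scale_ge arm_ge small_parts_rare thin_rare num_partitions_ge_linear show ?thesis
  proof eventually_elim
    case (elim n)
    define D s where "D = arm n" and "s = side n"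
    define T where "T = sqrt (real n)"
    define l where "l = ln (real n)"
    define p where "p = real (num_partitions n)"
    have T: "T / 2000 \<le> T / 1280 - 1" "1 \<le> T / 2000" "500 \<le> l" "l \<le> T" "T\<^sup>2 = real n"
      using elim(6) by (auto simp: T_def l_def)
    have D_ge: "T * l / 500 \<le> real D" using elim(2) by (simp add: D_def T_def l_def)
    have sc: "T / 5 \<le> real (scale n)" "real (scale n) \<le> T / 4"
      using elim(1) scale_le[of n] by (auto simp: T_def)
    have "scale n < 256 * s + 256" by (simp add: s_def side_def)
    then have "real (scale n) < 256 * real s + 256" by linarith
    then have s_ge: "T / 2000 \<le> real s" using sc(1) T(1) by linarith
    then have "0 < real s" using T(2) by linarith
    then have s0: "0 < s" by simp
    have "T * 500 \<le> T * l" using T by (intro mult_left_mono) auto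
    then have "T \<le> real D" using D_ge by linarith
    moreover have "real s \<le> real (scale n)" by (simp add: s_def side_def)
    ultimately have "real s \<le> real D" using sc T by linarith
    then have sD: "s \<le> D" by simp
    have "real (nat \<lfloor>l / 80\<rfloor>) * real (scale n) \<le> T * T"
      using sc T by (intro mult_mono) linarith+
    then have "real D \<le> real n" using T(5) by (simp add: D_def arm_def l_def power2_eq_square)
    then have Dn: "D \<le> n" by simp
    have Dp: "D \<le> num_partitions n" using Dn elim(5) by linarith
    have p0: "0 \<le> p" by (simp add: p_def)
    have rare: "real (card {xs \<in> partitions n. \<not> fat D s xs}) \<le> 3 * (p / l)"
    proof -
      have "real (card {xs \<in> partitions n. \<not> fat D s xs}) \<le> real (2 * pcount {1..D} (int n)
        + card {M \<in> parts_in {1..} (int n). size (filter_mset (\<lambda>x. s < x) M) \<le> s})"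
        by (simp only: of_nat_le_iff card_not_fat)
      moreover have "real (pcount {1..D} (int n)) \<le> p / l"
        using elim(3) T(3) by (simp add: D_def p_def l_def num_partitions_eq pos_le_divide_eq)
      moreover have "real (card {M \<in> parts_in {1..} (int n). size (filter_mset (\<lambda>x. s < x) M) \<le> s}) \<le> p / l"
        using elim(4) T(3) by (simp add: s_def p_def l_def num_partitions_eq pos_le_divide_eq)
      ultimately show ?thesis by simp
    qed
    have bound: "real (card S) \<le> 300000003 * (p / l)"
      if S: "S \<subseteq> partitions n" "packable (partition_rectangle n) S" for S
    proof -
      have finS: "finite S" using S(1) finite_partitions by (rule finite_subset)
      obtain P where P: "\<forall>xs\<in>S. is_placement xs (P xs) \<and> P xs \<subseteq> partition_rectangle n"
        "disjoint_family_on (\<lambda>xs. interior (P xs)) S"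
        using S(2) unfolding packable_def by blast
      let ?F = "{xs \<in> S. fat D s xs}"
      have "real (card ?F) \<le> 300 * real n * real (num_partitions n) / (real D * real s)"
      proof (rule card_fat_packing[where P = P])
        show "\<forall>xs\<in>?F. fat D s xs \<and> (\<forall>x\<in>set xs. 0 < x)" using S(1) by (auto simp: partitions_def)
        show "\<forall>xs\<in>?F. is_placement xs (P xs) \<and> P xs \<subseteq> {0..real n} \<times> {0..real (num_partitions n)}"
          using P(1) by (simp add: partition_rectangle_def)
        show "disjoint_family_on (\<lambda>xs. interior (P xs)) ?F"
          using P(2) by (rule disjoint_family_on_mono[rotated]) auto
      qed (use finS s0 sD Dn Dp in simp_all)
      also have "\<dots> = 300 * real n * p / (real D * real s)" by (simp add: p_def)
      also have "\<dots> \<le> 300 * real n * p / ((T * l / 500) * (T / 2000))"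
        using p0 T D_ge s_ge by (intro divide_left_mono mult_mono mult_nonneg_nonneg mult_pos_pos) (use s0 sD in auto)
      also have "\<dots> = 300000000 * (p / l)"
      proof -
        have "T \<noteq> 0" "l \<noteq> 0" using T by auto
        then show ?thesis unfolding T(5)[symmetric] by (simp add: power2_eq_square)
      qed
      finally have fat: "real (card ?F) \<le> 300000000 * (p / l)" .
      have "S = ?F \<union> {xs \<in> S. \<not> fat D s xs}" by blast
      then have "card S \<le> card ?F + card {xs \<in> S. \<not> fat D s xs}" by (metis card_Un_le)
      also have "card {xs \<in> S. \<not> fat D s xs} \<le> card {xs \<in> partitions n. \<not> fat D s xs}"
        using S(1) by (intro card_mono) (auto simp: finite_partitions)
      finally have "real (card S) \<le> real (card ?F) + real (card {xs \<in> partitions n. \<not> fat D s xs})" by linarith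
      with fat rare show ?thesis by linarith
    qed
    have "max_packing n \<in> packing_sizes n"
      unfolding max_packing_def by (rule Max_in[OF finite_packing_sizes packing_sizes_nonempty])
    then obtain S where "S \<subseteq> partitions n" "packable (partition_rectangle n) S" "max_packing n = card S"
      unfolding packing_sizes_def by blast
    with bound show ?case by (simp add: p_def l_def)
  qed
qed

text \<open>Partitions with a part above \<open>W = 2 r i\<close> are counted by \<open>n\<close> times the partition number at \<open>n - W\<close>,
  which is smaller than the one at \<open>n\<close> by a factor of \<open>2^i\<close>. By conjugation the same bound holds for
  partitions with more than \<open>W\<close> parts.\<close>

lemma card_bounded_partitions_ge:
  assumes r: "0 < r" "2 * n \<le> r\<^sup>2" and i: "4 * n \<le> 2 ^ i"
  shows "num_partitions n \<le> 2 * card {xs \<in> partitions n. length xs \<le> 2 * r * i \<and> (\<forall>x\<in>set xs. x \<le> 2 * r * i)}"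
    (is "_ \<le> 2 * card ?G")
proof -
  let ?W = "2 * r * i"
  let ?L = "{M \<in> parts_in {1..} (int n). \<exists>x\<in>#M. ?W < x}"
  let ?Z = "{M \<in> parts_in {1..} (int n). ?W < size M}"
  let ?B = "{xs \<in> partitions n. \<not> (size (mset xs) \<le> ?W \<and> (\<forall>x\<in>#mset xs. x \<le> ?W))}"
  have "2 ^ i * pcount {1..} (int n - 2 * int r * int i) \<le> pcount {1..} (int n)"
  proof (rule pcount_halving_iter)
    have "int (2 * n) \<le> int (r\<^sup>2)" using r(2) by (simp only: of_nat_le_iff)
    then show "2 * int n \<le> int (r\<^sup>2)" by simp
  qed (use r in auto)
  moreover have "2 * int r * int i = int ?W" by simp
  ultimately have "2 ^ i * pcount {1..} (int n - int ?W) \<le> num_partitions n"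
    by (simp only: num_partitions_eq)
  moreover have "4 * n * pcount {1..} (int n - int ?W) \<le> 2 ^ i * pcount {1..} (int n - int ?W)"
    using i by (rule mult_right_mono) simp
  ultimately have small: "4 * (n * pcount {1..} (int n - int ?W)) \<le> num_partitions n" by linarith
  have "card ?B = card {M \<in> parts_in {1..} (int n). \<not> (size M \<le> ?W \<and> (\<forall>x\<in>#M. x \<le> ?W))}"
    by (rule card_partitions_mset)
  also have "\<dots> \<le> card (?L \<union> ?Z)"
    by (intro card_mono) (auto simp: finite_parts_in not_le)
  also have "\<dots> \<le> card ?L + card ?Z" by (rule card_Un_le)
  finally have "card ?B \<le> card ?L + card ?Z" .
  moreover have "card ?Z \<le> card ?L" by (rule card_size_gr)
  moreover have "card ?L \<le> n * pcount {1..} (int n - int ?W)" by (rule card_large_part_le)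
  ultimately have "2 * card ?B \<le> num_partitions n" using small by linarith
  moreover have "num_partitions n \<le> card ?G + card ?B"
  proof -
    have "partitions n = ?G \<union> ?B" by auto
    then have "num_partitions n = card (?G \<union> ?B)" by (simp add: num_partitions_def)
    then show ?thesis using card_Un_le[of ?G ?B] by linarith
  qed
  ultimately show ?thesis by linarith
qed

text \<open>With \<open>r\<close> of order \<open>\<surd>n\<close> and \<open>W\<close> of order \<open>\<surd>n * ln n\<close> there are about \<open>n / (2 r)\<close> slots on each of
  about \<open>p(n) / (4 W)\<close> diagonals, and at least half of all shapes fit into any slot.\<close>

lemma max_packing_lower:
  "\<forall>\<^sub>F n in sequentially. 1 / 640 * (real (num_partitions n) / ln (real n)) \<le> real (max_packing n)"
proof -
  have "\<forall>\<^sub>F n in sequentially. 20 \<le> sqrt (real n) \<and> 1 \<le> ln (real n)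
      \<and> 32 * ln (real n) \<le> sqrt (real n)"
    by (intro eventually_conj) real_asymp+
  with num_partitions_ge_linear show ?thesis
  proof eventually_elim
    case (elim n)
    define T where "T = sqrt (real n)"
    define l where "l = ln (real n)"
    define p where "p = num_partitions n"
    have T: "20 \<le> T" "1 \<le> l" "32 * l \<le> T" "T\<^sup>2 = real n" using elim(2) by (auto simp: T_def l_def)
    have n0: "0 < n" using T by (cases n) (auto simp: T_def)
    obtain r where r: "0 < r" "2 * n \<le> r\<^sup>2" "r\<^sup>2 \<le> 4 * n" using square_between[OF n0] by blast
    have "(real r)\<^sup>2 \<le> (2 * T)\<^sup>2"
    proof -
      have "real (r\<^sup>2) \<le> real (4 * n)" using r(3) by (simp only: of_nat_le_iff)
      then show ?thesis using T(4) by (simp add: power_mult_distrib)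
    qed
    then have rT: "real r \<le> 2 * T" by (rule power2_le_imp_le) (use T in simp)
    define i where "i = nat \<lceil>3 * l\<rceil>"
    have i: "3 * l \<le> real i" "real i \<le> 4 * l" using T(2) unfolding i_def by linarith+
    define W where "W = 2 * r * i"
    have W: "real W \<le> 16 * T * l"
    proof -
      have "real r * real i \<le> (2 * T) * (4 * l)" using rT i T by (intro mult_mono) auto
      moreover have "real W = 2 * (real r * real i)" by (simp add: W_def)
      ultimately show ?thesis by linarith
    qed
    have "0 < real i" using i T by linarith
    then have W0: "0 < W" using r by (simp add: W_def)
    have "2 * real W \<le> T * (32 * l)" using W by simp
    also have "\<dots> \<le> T * T" using T by (intro mult_left_mono) auto
    finally have "2 * real W \<le> real n" using T(4) by (simp add: power2_eq_square)
    then have Wn: "2 * W \<le> n" by linarith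
    have i4: "4 * n \<le> 2 ^ i"
    proof -
      have "real n * real n = exp (2 * l)" using n0 by (simp add: l_def exp_double power2_eq_square)
      also have "\<dots> \<le> exp (real i * ln 2)"
      proof (subst exp_le_cancel_iff)
        have "2 * l \<le> real i * (2 / 3)" using i by simp
        also have "\<dots> \<le> real i * ln 2" using ln2_ge_two_thirds by (intro mult_left_mono) auto
        finally show "2 * l \<le> real i * ln 2" .
      qed
      also have "\<dots> = 2 ^ i" by (simp add: exp_of_nat_mult)
      finally have "real (n * n) \<le> real (2 ^ i)" by simp
      then have "n * n \<le> 2 ^ i" by (simp only: of_nat_le_iff)
      moreover have "4 \<le> n"
      proof -
        have "20 * 20 \<le> T * T" using T by (intro mult_mono) auto
        then show ?thesis using T(4) by (simp add: power2_eq_square)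
      qed
      then have "4 * n \<le> n * n" by simp
      ultimately show ?thesis by linarith
    qed
    define G where "G = {xs \<in> partitions n. length xs \<le> W \<and> (\<forall>x\<in>set xs. x \<le> W)}"
    have G: "p \<le> 2 * card G"
      using card_bounded_partitions_ge[OF r(1,2) i4] by (simp add: G_def W_def p_def)
    define I where "I = n div (2 * r)"
    define J where "J = p div (4 * W)"
    have Ir: "2 * (I * r) \<le> n" unfolding I_def using div_times_less_eq_dividend[of n "2 * r"] by (simp add: mult_ac)
    have WJ: "2 * (2 * W * J) \<le> p" unfolding J_def using div_times_less_eq_dividend[of p "4 * W"] by (simp add: mult_ac)
    have "min (I * J) (card G) \<le> card G" by (rule min.cobounded2)
    then obtain S where S: "S \<subseteq> G" "card S = min (I * J) (card G)"
      by (rule obtain_subset_with_card_n)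
    have "packable (partition_rectangle n) S"
    proof (rule packable_bounded_partitions[where r = r and I = I and J = J and W = W])
      show "S \<subseteq> partitions n" "\<forall>xs\<in>S. length xs \<le> W \<and> (\<forall>x\<in>set xs. x \<le> W)"
        using S(1) by (auto simp: G_def)
      show "card S \<le> I * J" using S(2) by simp
      show "n < (r + 1)\<^sup>2" using r(2) by (simp add: power2_eq_square)
      show "I * r + W \<le> n" using Ir Wn by linarith
      show "I * r + 2 * W * J \<le> num_partitions n" using Ir WJ elim(1) unfolding p_def by linarith
    qed
    moreover have "S \<subseteq> partitions n" using S(1) by (auto simp: G_def)
    ultimately have "card S \<in> packing_sizes n" unfolding packing_sizes_def by blast
    then have M: "card S \<le> max_packing n" unfolding max_packing_def by (rule Max_ge[OF finite_packing_sizes])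
    have I_ge: "T / 5 \<le> real I"
    proof -
      have "n < (2 * r) * (I + 1)"
        unfolding I_def using r(1) dividend_less_times_div[of "2 * r" n] by simp
      then have "real n < real ((2 * r) * (I + 1))" by (simp only: of_nat_less_iff)
      also have "\<dots> = 2 * real r * (real I + 1)" by (simp add: algebra_simps)
      also have "\<dots> \<le> 2 * (2 * T) * (real I + 1)" using rT by (intro mult_mono) auto
      finally have "T * T < T * (4 * (real I + 1))" using T(4) by (simp add: power2_eq_square algebra_simps)
      then have "T < 4 * (real I + 1)" using T by (simp add: mult_less_cancel_left_pos)
      then have "T / 4 - 1 < real I" by simp
      moreover have "T / 5 \<le> T / 4 - 1" using T(1) by simp
      ultimately show ?thesis by linarith
    qed
    have J_ge: "real p / (128 * T * l) \<le> real J"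
    proof -
      have "p < (4 * W) * (J + 1)"
        unfolding J_def using W0 dividend_less_times_div[of "4 * W" p] by simp
      then have "real p < real ((4 * W) * (J + 1))" by (simp only: of_nat_less_iff)
      also have "\<dots> = 4 * real W * (real J + 1)" by (simp add: algebra_simps)
      also have "\<dots> \<le> (64 * T * l) * (real J + 1)" using W by (intro mult_right_mono) auto
      finally have 1: "real p < (64 * T * l) * (real J + 1)" .
      have "128 * (T * l) \<le> 128 * (T * T)" using T by (intro mult_left_mono) auto
      also have "\<dots> = real (128 * n)" using T(4) by (simp add: power2_eq_square)
      also have "\<dots> \<le> real p" unfolding p_def using elim(1) by (simp only: of_nat_le_iff)
      finally have "real p \<le> (128 * T * l) * real J" using 1 by (simp add: algebra_simps)
      moreover have "0 < 128 * T * l" using T by simp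
      ultimately show ?thesis by (simp add: pos_divide_le_eq mult.commute)
    qed
    have "1 / 640 * (real p / l) = (T / 5) * (real p / (128 * T * l))" using T by (simp add: field_simps)
    also have "\<dots> \<le> real I * real J" using I_ge J_ge T by (intro mult_mono) auto
    finally have IJ: "1 / 640 * (real p / l) \<le> real (I * J)" by simp
    have "real p / l \<le> real p / 1" using T by (intro divide_left_mono) auto
    then have "1 / 640 * (real p / l) \<le> real (card G)" using G by simp
    with IJ have "1 / 640 * (real p / l) \<le> real (min (I * J) (card G))" by (simp add: min_def)
    with S(2) M show ?case by (simp add: p_def l_def)
  qed
qed

theorem mainTheorem2:
  "\<exists>a b :: real. \<exists>n0 :: nat. 0 < a \<and> 0 < b \<and>
     (\<forall>n\<ge>n0. a * (real (num_partitions n) / ln (real n)) \<le> real (max_packing n) \<and>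
              real (max_packing n) \<le> b * (real (num_partitions n) / ln (real n)))"
proof -
  from eventually_conj[OF max_packing_lower max_packing_upper] obtain n0 where
    "\<forall>n\<ge>n0. 1 / 640 * (real (num_partitions n) / ln (real n)) \<le> real (max_packing n) \<and>
       real (max_packing n) \<le> 300000003 * (real (num_partitions n) / ln (real n))"
    unfolding eventually_sequentially by blast
  then show ?thesis
    by (intro exI[of _ "1 / 640"] exI[of _ 300000003] exI[of _ n0]) simp
qed

end
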